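(* Let $P$, $Q$ be the Berele $P$-symbol and $Q$-symbol of a word $w$ of length $f$ in $\varGamma_n$, and put $Q = ( \kappa^{(0)}, \kappa^{(1)}, \dots, \kappa^{(f)} )$. Put $l = \max \{\, l( \kappa^{(j)} ) \mid 0 \le j \le f \,\}$, and let $\gamma = m$ or $\bar m$ ($m \in \mathbb N$) be the largest letter in $P$. \begin{enumerate} \item If $m > l$, then $\gamma$ is the largest letter in $w$, so that the bottom row of cells in the picture belongs to the $\gamma$-stratum, and $P^{(f-1)}$ is obtained from $P$ by deleting the rightmost occurrence of $\gamma$. \end{enumerate} In the remaining cases, assume that $m \le l$. \begin{enumerate} \item[(2)] If $P$ contains a letter $\bar l$, then it is also the largest letter in $w$, so that the bottom row of the picture belongs to the $\bar l$-stratum, and $P^{(f-1)}$ is obtained from $P$ by deleting the rightmost occurrence of $\bar l$. \item[(3)] If $P$ does not contain the letter $\bar l$, and if there is no $l$-shrink in $Q$ (i.e.\ $\kappa^{(j-1)} \supset \kappa^{(j)}$ with the removed box in row $l$ never occurs), then $l$ is the largest letter in $w$ (also in $P$), so that the bottom row of the picture belongs to the $l$-stratum, and $P^{(f-1)}$ is obtained from $P$ by deleting the rightmost occurrence of $l$. \end{enumerate} Now suppose that $P$ does not contain the letter $\bar l$, and that there is an $l$-shrink in $Q$. Let $\bar P$ be the tableau obtained from $P$ by adding an $l$ to the bottom of the first column of $P$ which does not already contain $l$. Put $Q$ on the bottom edge of a $1 \times f$ grid, and put the shape of $\bar P$ at the rightmost vertex of the upper level. Work backwards by local rules from right to left so long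 as the vertical segment remains a shrink, assuming that we are in the $\bar l$-stratum. \begin{enumerate} \item[(4)] If we reach the leftmost edge in this test, then $P^{(f-1)}$ cannot be equal to $\bar P$. In this case $l$ is the largest letter in $w$ (also in $P$), so that the bottom row of the picture must belong to the $l$-stratum, and $P^{(f-1)}$ is obtained from $P$ by deleting the rightmost occurrence of $l$. \item[(5)] If we encounter the case ($\bigcirc$) before reaching the leftmost edge, then we have $P^{(f-1)} = \bar P$. In this case the largest letter in $w$ is $\bar l$, so that the bottom row of the picture belongs to the $\bar l$-stratum. \end{enumerate}
   Context: Fix $n\ge1$ and the totally ordered alphabet $\varGamma_n=\{1<\bar1<2<\bar2<\cdots<n<\bar n\}$. An $Sp(2n)$-tableau is a semistandard tableau (rows weakly increasing, columns strictly increasing) with entries in $\varGamma_n$ such that every entry in row $i$ is $\ge i$. Berele's correspondence maps a word $w=w_1\cdots w_f$ in $\varGamma_n$ to a pair $(P,Q)$: $P$ is obtained by successively Berele-inserting $w_1,\dots,w_f$ into the empty tableau, and $Q=(\kappa^{(0)}=\varnothing,\kappa^{(1)},\dots,\kappa^{(f)})$ is the sequence of shapes of the intermediate tableaux (consecutive shapes differ by adding or removing one box). Berele insertion is Schensted row insertion, except that when a letter $k$ bumps a $\bar k$ out of row $k$ the $k$ and $\bar k$ are cancelled and the resulting hole is moved to a corner by jeu de taquin slides. Picture of $w$: standardize $w$ (the occurrences of each letter $\gamma$ become $\gamma_1,\gamma_2,\dots$ from left to right, ordered $\gamma_1<\gamma_2<\cdots$ and then by $\gamma$), let $\operatorname{ord}$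 be the order-preserving bijection of the standardized letters onto $[1,f]$, and in an $f\times f$ grid of cells (matrix coordinates, vertices $(i,j)$, $0\le i,j\le f$) put an $\times$ in cell $(\operatorname{ord}(\tilde w_j),j)$. The rows of cells $i$ with $i$ the ordinal of some standardized copy of $\gamma$ form the $\gamma$-stratum. For a vertex $(i,j)$, $\varLambda(i,j)$ is the shape of the Berele $P$-symbol of the subword of $w_1\cdots w_j$ consisting of the letters whose standardized ordinal is $\le i$; the bottom edge of the picture is $Q$, and $P^{(i)}$ denotes the Berele $P$-symbol attached to the rightmost vertex $(i,f)$, with $P^{(f)}=P$. A vertical segment $(i-1,j)$--$(i,j)$ is a growth/shrink if $\varLambda(i,j)$ covers/is covered by $\varLambda(i-1,j)$. Local rules, for a cell with vertices $A=(i-1,j-1)$, $B=(i-1,j)$, $C=(i,j-1)$, $D=(i,j)$: (carry-over, empty cell) if $\varLambda(A)=\varLambda(B)$ then $\varLambda(C)=\varLambda(D)$, and if $\varLambda(A)=\varLambda(C)$ then $\varLambda(B)=\varLambda(D)$; ($\times$) cell contains $\times$, $\varLambda(A)=\varLambda(B)=\varLambda(C)$, $\varLambda(D)$ is $\varLambda(C)$ plus a box in row 1; (M) $\varLambda(B)$, $\varLambda(C)$ are $\varLambda(A)$ plus a box in rows $k\ne k'$, $\varLambda(D)=\varLambda(B)\cup\varLambda(C)$; (R) $\varLambda(B)=\varLambda(C)$ is $\varLambda(A)$ plus a box in row $k$, cell in stratum $\ge k+1$, $\varLambda(D)$ is $\varLambda(B)$ plus a box in row $k+1$; ($\bigcirc$)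 same shapes as (R) but cell in stratum $\le\bar k$, $\varLambda(D)=\varLambda(A)$; (jeu de taquin) $\varLambda(A)\subset\varLambda(B)$ and $\varLambda(C)\subset\varLambda(A)$ (one box each): $\varLambda(D)=\varLambda(A)$ if $\varLambda(B)/\varLambda(C)$ is a domino, else $\varLambda(D)=\varLambda(C)\cup(\varLambda(B)\setminus\varLambda(A))$; symmetrically $\varLambda(B)\subset\varLambda(A)\subset\varLambda(C)$: $\varLambda(D)=\varLambda(A)$ if $\varLambda(C)/\varLambda(B)$ is a domino, else $\varLambda(D)=\varLambda(B)\cup(\varLambda(C)\setminus\varLambda(A))$; (W) $\varLambda(B)$, $\varLambda(C)$ are $\varLambda(A)$ minus a box in rows $k\ne k'$, $\varLambda(D)=\varLambda(B)\cap\varLambda(C)$; (Ya) $\varLambda(B)=\varLambda(C)$ is $\varLambda(A)$ minus a box in row $k\ge2$, $\varLambda(D)$ is $\varLambda(B)$ minus a box in row $k-1$. These rules are invertible: $\varLambda(B),\varLambda(C),\varLambda(D)$ and the stratum determine the case, the contents of the cell and $\varLambda(A)$ ("working backwards"). *)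

theory Defs
  imports Main
begin

section \<open>The alphabet\<close>

datatype letter = Plain nat | Bar nat

primrec index :: "letter \<Rightarrow> nat" where
  "index (Plain k) = k"
| "index (Bar k) = k"

primrec barred :: "letter \<Rightarrow> bool" where
  "barred (Plain k) \<longleftrightarrow> False"
| "barred (Bar k) \<longleftrightarrow> True"

instantiation letter :: linorder
begin

definition less_letter :: "letter \<Rightarrow> letter \<Rightarrow> bool" where
  "x < y \<longleftrightarrow> index x < index y \<or> index x = index y \<and> \<not> barred x \<and> barred y"

definition less_eq_letter :: "letter \<Rightarrow> letter \<Rightarrow> bool" where
  "x \<le> y \<longleftrightarrow> x < y \<or> x = y" for x y :: letter

instance
proof
  fix x y z :: letter
  show "x < y \<longleftrightarrow> x \<le> y \<and> \<not> y \<le> x"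
    by (auto simp: less_eq_letter_def less_letter_def)
  show "x \<le> x"
    by (simp add: less_eq_letter_def)
  show "x \<le> y \<Longrightarrow> y \<le> z \<Longrightarrow> x \<le> z"
    by (auto simp: less_eq_letter_def less_letter_def)
  show "x \<le> y \<Longrightarrow> y \<le> x \<Longrightarrow> x = y"
    by (auto simp: less_eq_letter_def less_letter_def)
  show "x \<le> y \<or> y \<le> x"
    by (cases x; cases y) (auto simp: less_eq_letter_def less_letter_def)
qed

end

definition Gamma :: "nat \<Rightarrow> letter set" where
  "Gamma n = Plain ` {1..n} \<union> Bar ` {1..n}"

definition largest :: "letter \<Rightarrow> letter set \<Rightarrow> bool" where
  "largest x S \<longleftrightarrow> x \<in> S \<and> (\<forall>y\<in>S. y \<le> x)"


section \<open>Shapes and tableaux\<close>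

text \<open>A cell is a pair (row, column), both counted from 1; a shape is its set of cells, and a
  tableau is a partial map from cells to letters, whose shape is its domain.\<close>

type_synonym shape = "(nat \<times> nat) set"
type_synonym tableau = "nat \<times> nat \<rightharpoonup> letter"

definition is_diagram :: "shape \<Rightarrow> bool" where
  "is_diagram S \<longleftrightarrow> finite S \<and> (\<forall>(r, c)\<in>S. 1 \<le> r \<and> 1 \<le> c \<and> {1..r} \<times> {1..c} \<subseteq> S)"

definition nrows :: "shape \<Rightarrow> nat" where
  "nrows S = card (fst ` S)"

definition plus_box :: "nat \<Rightarrow> shape \<Rightarrow> shape \<Rightarrow> bool" where
  "plus_box k A B \<longleftrightarrow> is_diagram A \<and> is_diagram B \<and> (\<exists>c. (k, c) \<notin> A \<and> B = insert (k, c) A)"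

definition covers :: "shape \<Rightarrow> shape \<Rightarrow> bool" where
  "covers B A \<longleftrightarrow> (\<exists>k. plus_box k A B)"

definition domino :: "shape \<Rightarrow> bool" where
  "domino S \<longleftrightarrow> (\<exists>r c. S = {(r, c), (r, Suc c)} \<or> S = {(r, c), (Suc r, c)})"


section \<open>Berele insertion\<close>

text \<open>The algorithm works on lists of nonempty rows, top row first.

  \<^term>\<open>slide a b rows\<close> moves a hole to a corner by jeu de taquin.  The top row of the
  configuration consists of the entries \<^term>\<open>a\<close>, the hole and the entries \<^term>\<open>b\<close>;
  \<^term>\<open>rows\<close> are the rows underneath.  If the entry below the hole is not larger than the entry
  to its right, then it moves up, otherwise the entry to the right moves left.\<close>

function slide :: "letter list \<Rightarrow> letter list \<Rightarrow> letter list list \<Rightarrow> letter list list" where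
  "slide a [] [] = (if a = [] then [] else [a])"
| "slide a (y # b) [] = slide (a @ [y]) b []"
| "slide a [] (row # rows) =
     (if length a < length row
      then (a @ [row ! length a]) # slide (take (length a) row) (drop (Suc (length a)) row) rows
      else a # row # rows)"
| "slide a (y # b) (row # rows) =
     (if length a < length row \<and> row ! length a \<le> y
      then (a @ row ! length a # y # b)
             # slide (take (length a) row) (drop (Suc (length a)) row) rows
      else slide (a @ [y]) b (row # rows))"
  by pat_completeness auto
termination
  by (relation "measures [\<lambda>(a, b, rows). length rows, \<lambda>(a, b, rows). length b]") auto

text \<open>\<^term>\<open>insert_from k x rows\<close> inserts \<^term>\<open>x\<close> into row \<^term>\<open>k\<close>, where
  \<^term>\<open>rows\<close> are the rows from row \<^term>\<open>k\<close> downwards.\<close>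

fun insert_from :: "nat \<Rightarrow> letter \<Rightarrow> letter list list \<Rightarrow> letter list list" where
  "insert_from k x [] = [[x]]"
| "insert_from k x (row # rows) =
     (let a = takeWhile (\<lambda>y. y \<le> x) row
      in case dropWhile (\<lambda>y. y \<le> x) row of
           [] \<Rightarrow> (row @ [x]) # rows
         | y # b \<Rightarrow>
             (if x = Plain k \<and> y = Bar k then slide a b rows
              else (a @ x # b) # insert_from (Suc k) y rows))"

definition berele_rows :: "letter list \<Rightarrow> letter list list" where
  "berele_rows w = fold (insert_from 1) w []"

definition filling :: "letter list list \<Rightarrow> tableau" where
  "filling T = (\<lambda>(r, c). if 1 \<le> r \<and> r \<le> length T \<and> 1 \<le> c \<and> c \<le> length (T ! (r - 1))
                        then Some (T ! (r - 1) ! (c - 1)) else None)"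

definition berele_P :: "letter list \<Rightarrow> tableau" where
  "berele_P w = filling (berele_rows w)"

definition berele_Q :: "letter list \<Rightarrow> shape list" where
  "berele_Q w = map (\<lambda>j. dom (berele_P (take j w))) [0..<Suc (length w)]"


section \<open>The picture of a word\<close>

text \<open>Positions in a word are counted from 0 here, rows of cells and vertices as in a matrix:
  column \<^term>\<open>Suc j\<close> of the picture belongs to the letter \<^term>\<open>w ! j\<close>.  The pair
  \<^term>\<open>(x, a)\<close> is the \<^term>\<open>a\<close>-th copy of the letter \<^term>\<open>x\<close>.\<close>

definition std_word :: "letter list \<Rightarrow> (letter \<times> nat) list" where
  "std_word w = map (\<lambda>j. (w ! j, card {p. p \<le> j \<and> w ! p = w ! j})) [0..<length w]"

definition std_le :: "letter \<times> nat \<Rightarrow> letter \<times> nat \<Rightarrow> bool" where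
  "std_le s t \<longleftrightarrow> fst s < fst t \<or> fst s = fst t \<and> snd s \<le> snd t"

definition std_ord :: "letter list \<Rightarrow> letter \<times> nat \<Rightarrow> nat" where
  "std_ord w s = card {t \<in> set (std_word w). std_le t s}"

definition in_stratum :: "letter list \<Rightarrow> letter \<Rightarrow> nat \<Rightarrow> bool" where
  "in_stratum w x i \<longleftrightarrow> (\<exists>s\<in>set (std_word w). fst s = x \<and> std_ord w s = i)"

definition vertex_word :: "letter list \<Rightarrow> nat \<Rightarrow> nat \<Rightarrow> letter list" where
  "vertex_word w i j = map ((!) w) (filter (\<lambda>p. std_ord w (std_word w ! p) \<le> i) [0..<j])"

definition vertex_P :: "letter list \<Rightarrow> nat \<Rightarrow> nat \<Rightarrow> tableau" where
  "vertex_P w i j = berele_P (vertex_word w i j)"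

definition P_level :: "letter list \<Rightarrow> nat \<Rightarrow> tableau" where
  "P_level w i = vertex_P w i (length w)"


section \<open>Local rules\<close>

datatype rule = CarryOver | Cross | RuleM | RuleR | Circ | JeuDeTaquin | RuleW | RuleYa

text \<open>\<^term>\<open>local_rule x \<rho> A B C D\<close>: in a cell of the \<^term>\<open>x\<close>-stratum with shapes
  \<^term>\<open>A\<close> (upper left), \<^term>\<open>B\<close> (upper right), \<^term>\<open>C\<close> (lower left) and \<^term>\<open>D\<close> (lower
  right), case \<^term>\<open>\<rho>\<close> takes place; the cell contains a cross only in case \<^term>\<open>Cross\<close>.

  In the strata of \<^term>\<open>Plain m\<close> and \<^term>\<open>Bar m\<close> shapes have at most \<^term>\<open>m\<close> rows,
  hence the condition on the stratum in \<^term>\<open>RuleYa\<close>.  It holds automatically when working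
  forwards; when working backwards it is what separates \<^term>\<open>RuleYa\<close> from \<^term>\<open>Circ\<close>.\<close>

inductive local_rule :: "letter \<Rightarrow> rule \<Rightarrow> shape \<Rightarrow> shape \<Rightarrow> shape \<Rightarrow> shape \<Rightarrow> bool" where
  carry_vertical:
    "is_diagram A \<Longrightarrow> is_diagram C \<Longrightarrow> A = C \<or> covers A C \<or> covers C A
       \<Longrightarrow> local_rule x CarryOver A A C C"
| carry_horizontal:
    "is_diagram A \<Longrightarrow> is_diagram B \<Longrightarrow> A = B \<or> covers A B \<or> covers B A
       \<Longrightarrow> local_rule x CarryOver A B A B"
| cross: "plus_box 1 A D \<Longrightarrow> local_rule x Cross A A A D"
| rule_M:
    "plus_box k A B \<Longrightarrow> plus_box k' A C \<Longrightarrow> k \<noteq> k' \<Longrightarrow> local_rule x RuleM A B C (B \<union> C)"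
| rule_R:
    "plus_box k A B \<Longrightarrow> Plain (k + 1) \<le> x \<Longrightarrow> plus_box (k + 1) B D \<Longrightarrow> local_rule x RuleR A B B D"
| rule_circ: "plus_box k A B \<Longrightarrow> x \<le> Bar k \<Longrightarrow> local_rule x Circ A B B A"
| jdt:
    "covers B A \<Longrightarrow> covers A C
       \<Longrightarrow> local_rule x JeuDeTaquin A B C (if domino (B - C) then A else C \<union> (B - A))"
| jdt_sym:
    "covers A B \<Longrightarrow> covers C A
       \<Longrightarrow> local_rule x JeuDeTaquin A B C (if domino (C - B) then A else B \<union> (C - A))"
| rule_W:
    "plus_box k B A \<Longrightarrow> plus_box k' C A \<Longrightarrow> k \<noteq> k' \<Longrightarrow> local_rule x RuleW A B C (B \<inter> C)"
| rule_Ya: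
    "plus_box k B A \<Longrightarrow> 2 \<le> k \<Longrightarrow> Plain k \<le> x \<Longrightarrow> plus_box (k - 1) D B \<Longrightarrow> local_rule x RuleYa A B B D"


section \<open>The test\<close>

text \<open>\<^term>\<open>\<kappa> 0\<close>, ..., \<^term>\<open>\<kappa> f\<close> are the shapes on the lower edge of a grid with one row and \<^term>\<open>f\<close>
  columns, \<^term>\<open>\<mu> j\<close> is the shape at the upper vertex in column \<^term>\<open>j\<close>, starting with
  \<^term>\<open>S\<close> at the rightmost one.  Working backwards has determined \<^term>\<open>\<mu> f\<close>, ..., \<^term>\<open>\<mu> j\<close>, and all
  vertical segments met so far are shrinks.\<close>

definition worked_back ::
    "letter \<Rightarrow> nat \<Rightarrow> (nat \<Rightarrow> shape) \<Rightarrow> shape \<Rightarrow> nat \<Rightarrow> (nat \<Rightarrow> shape) \<Rightarrow> bool" where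
  "worked_back x f \<kappa> S j \<mu> \<longleftrightarrow>
     \<mu> f = S \<and> (\<forall>i\<in>{j..f}. covers (\<mu> i) (\<kappa> i)) \<and>
     (\<forall>i\<in>{j<..f}. \<exists>\<rho>. local_rule x \<rho> (\<mu> (i - 1)) (\<mu> i) (\<kappa> (i - 1)) (\<kappa> i))"

definition reaches_left_edge :: "letter \<Rightarrow> nat \<Rightarrow> (nat \<Rightarrow> shape) \<Rightarrow> shape \<Rightarrow> bool" where
  "reaches_left_edge x f \<kappa> S \<longleftrightarrow> (\<exists>\<mu>. worked_back x f \<kappa> S 0 \<mu>)"

definition encounters_circ :: "letter \<Rightarrow> nat \<Rightarrow> (nat \<Rightarrow> shape) \<Rightarrow> shape \<Rightarrow> bool" where
  "encounters_circ x f \<kappa> S \<longleftrightarrow>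
     (\<exists>j\<in>{1..f}. \<exists>\<mu> A. worked_back x f \<kappa> S j \<mu> \<and> local_rule x Circ A (\<mu> j) (\<kappa> (j - 1)) (\<kappa> j))"


section \<open>Modifications of the P-symbol\<close>

definition deletes_rightmost :: "letter \<Rightarrow> tableau \<Rightarrow> tableau \<Rightarrow> bool" where
  "deletes_rightmost x T T' \<longleftrightarrow>
     (\<exists>r c. T (r, c) = Some x \<and>
            (\<forall>r' c'. T (r', c') = Some x \<and> (r', c') \<noteq> (r, c) \<longrightarrow> c' < c) \<and>
            T' = T((r, c) := None))"

definition column_height :: "tableau \<Rightarrow> nat \<Rightarrow> nat" where
  "column_height T c = card {r. (r, c) \<in> dom T}"

text \<open>The first column without \<^term>\<open>x\<close> may be the empty column right of the tableau.\<close>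

definition first_column_without :: "letter \<Rightarrow> tableau \<Rightarrow> nat" where
  "first_column_without x T = (LEAST c. 1 \<le> c \<and> (\<forall>r. T (r, c) \<noteq> Some x))"

definition add_to_first_column :: "letter \<Rightarrow> tableau \<Rightarrow> tableau" where
  "add_to_first_column x T =
     (let c = first_column_without x T in T((column_height T c + 1, c) \<mapsto> x))"

end

(* Let g be the largest letter of w, and write w = u g v with g not in v. Leaving out this last g
   gives a tableau T, which is compared with the tableau U of w while v is inserted into both. At first
   U is T with one more g, and no row above this g contains another one; hence it is the rightmost g.
   The insertion of smaller letters preserves this, unless g is Bar m and the additional g is
   cancelled by a Plain m. At that moment the roles change: T becomes U with a Plain m added to the
   first column without Plain m, while U loses a box in row m, so that m = l.

   As long as no Bar m occurs, adding Plain m to the first column without Plain m commutes with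
   insertion, and the shapes before and after satisfy the local rules with vertical shrinks. Working
   backwards is deterministic, so the test retraces the shapes of these extended tableaux. If g is
   Plain l, they exist from the empty word on, and the test never meets the case of a circle; if g
   has been cancelled, the test cannot pass the column of the cancellation. *)

theory Submission
  imports Defs
begin

section \<open>Jeu de taquin slides\<close>

text \<open>The role of \<open>Plain m\<close> after a cancellation has a simple origin. All letters
  are at most \<open>Bar m\<close>, so row m is the last possible row, and when the additional
  \<open>Bar m\<close> is cancelled, everything to its left in that row is \<open>Plain m\<close>.
  The tableau without the additional letter appends the incoming \<open>Plain m\<close> there, while
  the other one loses its \<open>Bar m\<close>. For the same reason no intermediate shape has more
  than m rows; since row m is occupied at that moment, m must be the l of the theorem. The test sees
  only shapes. So it is not enough that an extension commutes with insertion; it must also be known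
  in which row the additional box lies before and after every letter. The obstacle is the moment
  when the additional letter is bumped: it has to land in the same column, one row lower, or the two
  boxes would not form a domino. The invariant \<open>full\<close> guarantees this. The bound of m
  rows keeps \<open>RuleYa\<close> apart from \<open>Circ\<close> in the stratum of
  \<open>Bar m\<close>.\<close>

abbreviation letters :: "letter list list \<Rightarrow> letter set" where
  "letters T \<equiv> set (concat T)"

definition top_row :: "letter list list \<Rightarrow> letter list" where
  "top_row T = (case T of [] \<Rightarrow> [] | R # _ \<Rightarrow> R)"

lemma top_row_simps [simp]: "top_row [] = []" "top_row (R # T) = R"
  by (simp_all add: top_row_def)

definition above :: "letter list \<Rightarrow> letter list \<Rightarrow> bool" where
  "above R S \<longleftrightarrow> length S \<le> length R \<and> (\<forall>i<length S. R ! i < S ! i)"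

text \<open>The parameter is the number of the top row, so that the lower rows of a tableau are
  again an instance. The symplectic condition on row k is the bound \<open>Plain k\<close>, and
  column strictness is stated for adjacent rows only.\<close>

fun sp_tableau :: "nat \<Rightarrow> letter list list \<Rightarrow> bool" where
  "sp_tableau k [] \<longleftrightarrow> True"
| "sp_tableau k (R # T) \<longleftrightarrow>
     R \<noteq> [] \<and> sorted R \<and> (\<forall>x\<in>set R. Plain k \<le> x) \<and> above R (top_row T) \<and> sp_tableau (Suc k) T"

lemma above_Nil [simp]: "above R []"
  by (simp add: above_def)

lemma Plain_le_iff: "Plain k \<le> x \<longleftrightarrow> k \<le> index x"
  by (cases x) (auto simp: less_eq_letter_def less_letter_def)

lemma le_Bar_iff: "x \<le> Bar k \<longleftrightarrow> index x \<le> k"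
  by (cases x) (auto simp: less_eq_letter_def less_letter_def)

lemma Plain_Suc_le_iff: "Plain (Suc k) \<le> x \<longleftrightarrow> Bar k < x"
  by (cases x) (auto simp: less_eq_letter_def less_letter_def)

lemma less_Bar_iff: "x < Bar k \<longleftrightarrow> x \<le> Plain k"
  by (cases x) (auto simp: less_eq_letter_def less_letter_def)

section \<open>Single moves of a hole, and the whole slide\<close>

lemma sorted_hole_right:
  assumes "sorted (a @ h # y # b)"
  shows "sorted ((a @ [y]) @ y # b)"
  using assms by (auto simp: sorted_append)

text \<open>The letter h is a placeholder in the hole, so that every configuration during a slide is
  an ordinary tableau. When y moves left, its old position keeps a copy of y as the new placeholder;
  hence y occurs twice in the conclusion. Only the entry at the old hole changes, so only its column
  has to be checked.\<close>

lemma sp_tableau_hole_right: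
  assumes "sp_tableau k ((a @ h # y # b) # T)"
    and "length a < length (top_row T) \<Longrightarrow> y < top_row T ! length a"
  shows "sp_tableau k (((a @ [y]) @ y # b) # T)"
proof -
  have ab: "above (a @ h # y # b) (top_row T)"
    using assms(1) by simp
  have eq: "(a @ [y]) @ y # b = (a @ h # y # b)[length a := y]"
    by (simp add: list_update_append)
  have "((a @ [y]) @ y # b) ! i < top_row T ! i" if i: "i < length (top_row T)" for i
  proof -
    have "((a @ [y]) @ y # b) ! i = (if i = length a then y else (a @ h # y # b) ! i)"
      unfolding eq using ab i by (subst nth_list_update) (auto simp: above_def)
    then show ?thesis
      using ab i assms(2) by (auto simp: above_def)
  qed
  then have "above ((a @ [y]) @ y # b) (top_row T)"
    using ab by (simp add: above_def)
  moreover have "sorted ((a @ [y]) @ y # b)"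
    using assms(1) by (intro sorted_hole_right[of a h]) simp
  ultimately show ?thesis using assms(1) by auto
qed

text \<open>An entry left of the hole is smaller than the entry below it, which in turn is at most
  the entry below the hole. The entries right of the hole are bounded from below by the slide rule
  itself.\<close>

lemma sorted_hole_down:
  assumes "sp_tableau k ((a @ h # b) # R # T)" and "length a < length R"
    and "\<And>y b'. b = y # b' \<Longrightarrow> R ! length a \<le> y"
  shows "sorted (a @ R ! length a # b)"
proof -
  have 1: "sorted (a @ h # b)" "sorted R" "above (a @ h # b) R"
    using assms(1) by simp_all
  have "x \<le> R ! length a" if x: "x \<in> set a" for x
  proof -
    obtain i where i: "i < length a" "x = a ! i"
      using x by (auto simp: in_set_conv_nth)
    then have "i < length R"
      using assms(2) by simp
    then have "(a @ h # b) ! i < R ! i"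
      using 1(3) by (simp add: above_def)
    then have "x < R ! i"
      using i by (simp add: nth_append)
    also have "R ! i \<le> R ! length a"
      using 1(2) i assms(2) by (simp add: sorted_iff_nth_mono)
    finally show ?thesis by simp
  qed
  moreover have "R ! length a \<le> y" if "y \<in> set b" for y
    using that assms(3) 1(1) by (cases b) (force simp: sorted_append)+
  ultimately show ?thesis using 1(1) by (auto simp: sorted_append)
qed

text \<open>Here \<^term>\<open>a\<close>, the hole and \<^term>\<open>b\<close> form a row; the entries of \<^term>\<open>b\<close> must remain larger
  than the entries of \<^term>\<open>R\<close> above them even when they move one step to the left.\<close>

definition above_hole :: "letter list \<Rightarrow> letter list \<Rightarrow> letter list \<Rightarrow> letter list list \<Rightarrow> bool" where
  "above_hole R a b T \<longleftrightarrow>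
     length a + length b < length R \<and> (\<forall>i<length a. R ! i < a ! i) \<and>
     (\<forall>j<length b. R ! (length a + j) < b ! j \<and> R ! Suc (length a + j) < b ! j) \<and>
     (length a < length (top_row T) \<longrightarrow> R ! length a < top_row T ! length a)"

lemma above_hole_right:
  assumes "above_hole R a (y # b) T" "sp_tableau k ((a @ h # y # b) # T)"
  shows "above_hole R (a @ [y]) b T"
  unfolding above_hole_def
proof (intro conjI allI impI)
  have y: "R ! length a < y" "R ! Suc (length a) < y"
    using assms(1) by (auto simp: above_hole_def dest: spec[of _ 0])
  show "length (a @ [y]) + length b < length R"
    using assms(1) by (simp add: above_hole_def)
  show "R ! i < (a @ [y]) ! i" if "i < length (a @ [y])" for i
    using assms(1) that y by (auto simp: above_hole_def nth_append less_Suc_eq)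
  show "R ! (length (a @ [y]) + j) < b ! j" "R ! Suc (length (a @ [y]) + j) < b ! j"
    if "j < length b" for j
    using assms(1) that by (auto simp: above_hole_def dest: spec[of _ "Suc j"])
  assume len: "length (a @ [y]) < length (top_row T)"
  have "above (a @ h # y # b) (top_row T)"
    using assms(2) by simp
  then have "(a @ h # y # b) ! length (a @ [y]) < top_row T ! length (a @ [y])"
    using len unfolding above_def by blast
  then have "y < top_row T ! length (a @ [y])"
    by (simp add: nth_append)
  then show "R ! length (a @ [y]) < top_row T ! length (a @ [y])"
    using y by simp
qed

lemma above_hole_filled:
  assumes "above_hole R a b T" "length a < length (top_row T)"
  shows "above R (a @ top_row T ! length a # b)"
  unfolding above_def
proof (intro conjI allI impI)
  show "length (a @ top_row T ! length a # b) \<le> length R"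
    using assms(1) by (simp add: above_hole_def)
  fix i assume i: "i < length (a @ top_row T ! length a # b)"
  consider "i < length a" | "i = length a" | j where "i = Suc (length a + j)" "j < length b"
    using i by (auto simp: not_less) (metis Suc_less_eq add_Suc_right less_imp_Suc_add linorder_neqE_nat
        nat_add_left_cancel_less)
  then show "R ! i < (a @ top_row T ! length a # b) ! i"
    using assms by cases (auto simp: above_hole_def nth_append)
qed

text \<open>Right of the hole, column strictness of the old rows gives the comparison with the entry
  straight above. The comparison with the entry one step further left follows because b is weakly
  increasing and, at the letter just moved up, from the slide rule.\<close>

lemma above_hole_down:
  assumes "sp_tableau k ((a @ h # b) # R # T)" and "length a < length R"
    and "\<And>y b'. b = y # b' \<Longrightarrow> R ! length a \<le> y"
  shows "above_hole (a @ R ! length a # b) (take (length a) R) (drop (Suc (length a)) R) T"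
proof -
  let ?e = "R ! length a"
  have ab: "above (a @ h # b) R" and aT: "above R (top_row T)" and sb: "sorted b"
    using assms(1) by (simp_all add: sorted_append)
  have lt: "(a @ h # b) ! i < R ! i" if "i < length R" for i
    using ab that by (simp add: above_def)
  have len: "length R \<le> Suc (length a + length b)"
    using ab by (simp add: above_def)
  have shift: "b ! j < R ! (Suc (length a + j))" if "j < length R - Suc (length a)" for j
    using lt[of "Suc (length a + j)"] that by (simp add: nth_append)
  have "(a @ ?e # b) ! (length a + j) < R ! (Suc (length a + j))" if j: "j < length R - Suc (length a)" for j
  proof (cases j)
    case 0
    then obtain y b' where b: "b = y # b'"
      using len j by (cases b) auto
    then have "?e \<le> b ! 0"
      using assms(3) by simp
    then show ?thesis using shift[OF j] 0 by simp
  next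
    case (Suc i)
    then have "b ! i \<le> b ! j"
      using sb len j by (intro sorted_nth_mono) auto
    then show ?thesis using shift[OF j] Suc by (simp add: nth_append)
  qed
  moreover have "a ! i < R ! i" if "i < length a" for i
    using lt[of i] that assms(2) by (simp add: nth_append)
  ultimately show ?thesis
    using assms(2) len shift aT
    unfolding above_hole_def by (auto simp: nth_append above_def)
qed

lemma sp_tableau_hole_down:
  assumes "sp_tableau k ((a @ h # b) # R # T)" and "length a < length R"
  shows "sp_tableau (Suc k) ((take (length a) R @ R ! length a # drop (Suc (length a)) R) # T)"
  using assms by (simp add: id_take_nth_drop[symmetric])

text \<open>The second claim quantifies over every row R that could lie above the configuration. The
  induction needs it when the hole moves down: then R is the row which the hole has just
  left.\<close>

lemma slide_sp_tableau:
  assumes "sp_tableau k ((a @ h # b) # T)"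
  shows "sp_tableau k (slide a b T)"
    and "above_hole R a b T \<Longrightarrow> above R (top_row (slide a b T))"
proof -
  have down: "sp_tableau k ((a @ R ! length a # b) # slide (take (length a) R) (drop (Suc (length a)) R) T)"
    if "sp_tableau k ((a @ h # b) # R # T)" and "length a < length R"
      and "\<And>y b'. b = y # b' \<Longrightarrow> R ! length a \<le> y"
      and "sp_tableau (Suc k) (slide (take (length a) R) (drop (Suc (length a)) R) T)"
      and "\<And>R'. above_hole R' (take (length a) R) (drop (Suc (length a)) R) T \<Longrightarrow>
             above R' (top_row (slide (take (length a) R) (drop (Suc (length a)) R) T))"
    for a b h R T k
  proof -
    have "Plain k \<le> R ! length a"
      using that(1,2) by (auto simp: Plain_le_iff dest!: Suc_leD)
    then show ?thesis
      using that sorted_hole_down[OF that(1-3)] above_hole_down[OF that(1-3)] by auto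
  qed
  have "sp_tableau k (slide a b T) \<and>
      (\<forall>R. above_hole R a b T \<longrightarrow> above R (top_row (slide a b T)))"
    using assms
  proof (induction a b T arbitrary: h k rule: slide.induct)
    case (1 a)
    then show ?case by (auto simp: sorted_append above_hole_def above_def)
  next
    case (2 a y b)
    have "sp_tableau k (((a @ [y]) @ y # b) # [])"
      using sp_tableau_hole_right[OF 2(2)] by simp
    from 2(1)[OF this] above_hole_right[OF _ 2(2)] show ?case
      by auto
  next
    case (3 a R T)
    show ?case
    proof (cases "length a < length R")
      case True
      note IH = 3(1)[OF True sp_tableau_hole_down[OF 3(2) True]]
      show ?thesis
        using True IH down[OF 3(2) True] above_hole_filled[of _ a "[]" "R # T"] by auto
    next
      case False
      then show ?thesis
        using 3(2) by (auto simp: sorted_append above_hole_def above_def nth_append)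
    qed
  next
    case (4 a y b R T)
    show ?case
    proof (cases "length a < length R \<and> R ! length a \<le> y")
      case True
      then have len: "length a < length R" by simp
      note IH = 4(1)[OF True sp_tableau_hole_down[OF 4(3) len]]
      show ?thesis
        using True IH down[OF 4(3) len] above_hole_filled[of _ a "y # b" "R # T"] by auto
    next
      case False
      have "sp_tableau k (((a @ [y]) @ y # b) # R # T)"
        using sp_tableau_hole_right[OF 4(3)] False by auto
      from 4(2)[OF False this] above_hole_right[OF _ 4(3)] False show ?thesis
        by auto
    qed
  qed
  then show "sp_tableau k (slide a b T)" "above_hole R a b T \<Longrightarrow> above R (top_row (slide a b T))"
    by auto
qed

section \<open>Berele insertion\<close>

lemma insert_from_append:
  assumes "\<And>z. z \<in> set R \<Longrightarrow> z \<le> x"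
  shows "insert_from k x (R # T) = (R @ [x]) # T"
proof -
  have drop: "dropWhile (\<lambda>y. y \<le> x) R = []"
    using assms by simp
  show ?thesis by (simp only: insert_from.simps Let_def drop list.case)
qed

lemma insert_from_bump:
  assumes "\<And>z. z \<in> set a \<Longrightarrow> z \<le> x" and "x < y"
  shows "insert_from k x ((a @ y # b) # T) =
    (if x = Plain k \<and> y = Bar k then slide a b T else (a @ x # b) # insert_from (Suc k) y T)"
proof -
  have "takeWhile (\<lambda>y. y \<le> x) (a @ y # b) = a" "dropWhile (\<lambda>y. y \<le> x) (a @ y # b) = y # b"
    using assms by simp_all
  then show ?thesis by (simp add: insert_from.simps(2) Let_def)
qed

declare insert_from.simps(2) [simp del]

lemma insert_from_cancel:
  assumes "\<And>z. z \<in> set a \<Longrightarrow> z \<le> Plain k"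
  shows "insert_from k (Plain k) ((a @ Bar k # b) # T) = slide a b T"
  using insert_from_bump[OF assms, where y = "Bar k"] by (simp add: less_letter_def)

text \<open>Replaces the computation with \<open>takeWhile\<close> and \<open>dropWhile\<close> by
  the possible fates of a letter in a nonempty row: it is appended, it cancels, or it bumps y out of
  \<open>a @ y # b\<close>. Only a bump continues in the next row.\<close>

lemma insert_from_step_induct [case_names Nil append cancel bump]:
  assumes "\<And>k x. Q k x []"
    and "\<And>k x R T. (\<And>z. z \<in> set R \<Longrightarrow> z \<le> x) \<Longrightarrow> Q k x (R # T)"
    and "\<And>k a b T. (\<And>z. z \<in> set a \<Longrightarrow> z \<le> Plain k) \<Longrightarrow> Q k (Plain k) ((a @ Bar k # b) # T)"
    and "\<And>k x a y b T. (\<And>z. z \<in> set a \<Longrightarrow> z \<le> x) \<Longrightarrow> x < y \<Longrightarrow> \<not> (x = Plain k \<and> y = Bar k) \<Longrightarrow>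
           Q (Suc k) y T \<Longrightarrow> Q k x ((a @ y # b) # T)"
  shows "Q k x T"
proof (induction T arbitrary: k x)
  case Nil
  then show ?case by (rule assms(1))
next
  case (Cons R T)
  show ?case
  proof (cases "dropWhile (\<lambda>y. y \<le> x) R")
    case Nil
    then show ?thesis by (intro assms(2)) simp
  next
    case (Cons y b)
    then obtain a where R: "R = a @ y # b" and a: "\<And>z. z \<in> set a \<Longrightarrow> z \<le> x" and "x < y"
      unfolding dropWhile_eq_Cons_conv by (metis not_le set_takeWhileD)
    then show ?thesis
      using assms(3)[of a k b T] assms(4)[OF a, where y = y and k = k and T = T and b = b] Cons.IH
      by (cases "x = Plain k \<and> y = Bar k") auto
  qed
qed

text \<open>Strictly between \<open>Plain k\<close> and \<open>Plain (Suc k)\<close> there is only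
  \<open>Bar k\<close>. So cancellation is exactly the exception in which the bumped letter would
  violate the bound of the next row.\<close>

lemma Plain_Suc_le_bumped:
  assumes "Plain k \<le> x" "x < y" "\<not> (x = Plain k \<and> y = Bar k)"
  shows "Plain (Suc k) \<le> y"
  using assms by (cases x; cases y) (auto simp: Plain_le_iff less_letter_def)

definition insert_pos :: "letter \<Rightarrow> letter list \<Rightarrow> nat" where
  "insert_pos x R = length (takeWhile (\<lambda>y. y \<le> x) R)"

lemma above_hole_start:
  assumes "sp_tableau k ((a @ h # b) # T)" and "above R (a @ h # b)"
  shows "above_hole R a b T"
proof -
  have lt: "R ! i < (a @ h # b) ! i" if "i < length a + Suc (length b)" for i
    using assms(2) that by (simp add: above_def)
  have "R ! (length a + j) < b ! j" if j: "j < length b" for j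
  proof -
    have "sorted (h # b)"
      using assms(1) by (simp add: sorted_append)
    then have "(h # b) ! j \<le> (h # b) ! Suc j"
      using j by (intro sorted_nth_mono) auto
    then show ?thesis
      using lt[of "length a + j"] j by (simp add: nth_append)
  qed
  moreover have "R ! Suc (length a + j) < b ! j" if j: "j < length b" for j
    using lt[of "Suc (length a + j)"] j by (simp add: nth_append)
  moreover have "R ! i < a ! i" if "i < length a" for i
    using lt[of i] that by (simp add: nth_append)
  moreover have "R ! length a < top_row T ! length a" if "length a < length (top_row T)"
  proof -
    have "(a @ h # b) ! length a < top_row T ! length a"
      using assms(1) that unfolding sp_tableau.simps above_def by blast
    then show ?thesis
      using lt[of "length a"] by simp
  qed
  ultimately show ?thesis
    using assms(2) by (simp add: above_hole_def above_def)
qed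

text \<open>The second claim serves the induction: the letter must be larger than the entry of R
  over the place where it lands, and \<open>insert_pos\<close> names the column of that
  place.\<close>

lemma insert_from_sp_tableau:
  assumes "sp_tableau k T" "Plain k \<le> x"
  shows "sp_tableau k (insert_from k x T)"
    and "above R (top_row T) \<Longrightarrow> insert_pos x (top_row T) < length R \<Longrightarrow>
           R ! insert_pos x (top_row T) < x \<Longrightarrow> above R (top_row (insert_from k x T))"
proof -
  have "sp_tableau k (insert_from k x T) \<and>
    (\<forall>R. above R (top_row T) \<longrightarrow> insert_pos x (top_row T) < length R \<longrightarrow>
         R ! insert_pos x (top_row T) < x \<longrightarrow> above R (top_row (insert_from k x T)))"
    using assms
  proof (induction k x T rule: insert_from_step_induct)
    case (Nil k x)
    then show ?case by (auto simp: above_def insert_pos_def Suc_le_eq)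
  next
    case (append k x R T)
    have "insert_pos x R = length R"
      using append(1) by (simp add: insert_pos_def takeWhile_eq_all_conv[THEN iffD2])
    then show ?case
      using append insert_from_append[OF append(1), where T = T]
      by (auto simp: sorted_append above_def nth_append less_Suc_eq)
  next
    case (cancel k a b T)
    then show ?case
      using slide_sp_tableau[OF cancel(2)] above_hole_start[OF cancel(2)] insert_from_cancel[OF cancel(1)]
      by auto
  next
    case (bump k x a y b T)
    let ?S = "top_row T"
    have tab: "sp_tableau (Suc k) T" and ab: "above (a @ y # b) ?S" and s: "sorted (a @ y # b)"
      using bump.prems by simp_all
    have IH: "sp_tableau (Suc k) (insert_from (Suc k) y T)"
      "above R ?S \<Longrightarrow> insert_pos y ?S < length R \<Longrightarrow> R ! insert_pos y ?S < y \<Longrightarrow>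
        above R (top_row (insert_from (Suc k) y T))" for R
      using bump.IH tab Plain_Suc_le_bumped[OF bump.prems(2) bump.hyps(2,3)] by auto
    \<comment> \<open>A bumping path moves weakly left: the letter below y, if any, is larger than
      y, so y lands no further right than the column it comes from.\<close>
    have pos: "insert_pos y ?S \<le> length a"
    proof (rule ccontr)
      assume "\<not> ?thesis"
      then have l: "length a < length (takeWhile (\<lambda>z. z \<le> y) ?S)"
        by (simp add: insert_pos_def)
      then have "takeWhile (\<lambda>z. z \<le> y) ?S ! length a \<in> set (takeWhile (\<lambda>z. z \<le> y) ?S)"
        by (rule nth_mem)
      then have "takeWhile (\<lambda>z. z \<le> y) ?S ! length a \<le> y"
        using set_takeWhileD by fastforce
      then have "?S ! length a \<le> y"
        using l by (simp add: takeWhile_nth)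
      moreover have "length a < length ?S"
        using l length_takeWhile_le[of "\<lambda>z. z \<le> y" ?S] by simp
      then have "(a @ y # b) ! length a < ?S ! length a"
        using ab unfolding above_def by blast
      ultimately show False by simp
    qed
    have "above (a @ x # b) ?S"
    proof -
      have "(a @ x # b) ! i \<le> (a @ y # b) ! i" for i
        using bump.hyps(2) by (auto simp: nth_append nth_Cons split: nat.splits)
      then show ?thesis
        using ab by (auto simp: above_def intro: le_less_trans)
    qed
    moreover have "(a @ x # b) ! insert_pos y ?S < y"
    proof (cases "insert_pos y ?S = length a")
      case False
      then have "a ! insert_pos y ?S \<le> x"
        using pos by (intro bump.hyps(1)) simp
      then show ?thesis
        using False pos bump.hyps(2) by (simp add: nth_append)
    qed (use bump.hyps(2) in simp)
    ultimately have "above (a @ x # b) (top_row (insert_from (Suc k) y T))"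
      using pos by (intro IH(2)) simp_all
    moreover have "sorted (a @ x # b)"
      using s bump.hyps(1,2) by (force simp: sorted_append)
    ultimately have 1: "sp_tableau k ((a @ x # b) # insert_from (Suc k) y T)"
      using IH(1) bump.prems by auto
    have "insert_pos x (a @ y # b) = length a"
      using bump.hyps(1,2) by (simp add: insert_pos_def)
    then have 2: "above R (a @ x # b)" if "above R (a @ y # b)" "R ! insert_pos x (a @ y # b) < x" for R
    proof -
      have "R ! i < (a @ x # b) ! i" if i: "i < length (a @ x # b)" for i
      proof (cases "i = length a")
        case True
        then show ?thesis using \<open>R ! insert_pos x (a @ y # b) < x\<close> \<open>insert_pos x (a @ y # b) = length a\<close> by simp
      next
        case False
        then have "(a @ x # b) ! i = (a @ y # b) ! i"
          by (simp add: nth_append nth_Cons split: nat.splits)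
        then show ?thesis using \<open>above R (a @ y # b)\<close> i by (simp add: above_def)
      qed
      then show ?thesis using that(1) by (simp add: above_def)
    qed
    show ?case
      using 1 2 bump.hyps insert_from_bump[OF bump.hyps(1,2)] by auto
  qed
  then show "sp_tableau k (insert_from k x T)"
    "above R (top_row T) \<Longrightarrow> insert_pos x (top_row T) < length R \<Longrightarrow>
           R ! insert_pos x (top_row T) < x \<Longrightarrow> above R (top_row (insert_from k x T))"
    by auto
qed

section \<open>Letters under slides and insertions\<close>

lemma letters_slide: "letters (slide a b T) \<subseteq> set a \<union> set b \<union> letters T"
proof (induction a b T rule: slide.induct)
  case (3 a R T)
  show ?case
  proof (cases "length a < length R")
    case True
    have "set (take (length a) R) \<union> set (drop (Suc (length a)) R) \<subseteq> set R"
      by (simp add: set_take_subset set_drop_subset)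
    then have "letters (slide (take (length a) R) (drop (Suc (length a)) R) T) \<subseteq> set R \<union> letters T"
      using 3[OF True] by blast
    then show ?thesis using True nth_mem[OF True] by auto
  qed auto
next
  case (4 a y b R T)
  show ?case
  proof (cases "length a < length R \<and> R ! length a \<le> y")
    case True
    have "set (take (length a) R) \<union> set (drop (Suc (length a)) R) \<subseteq> set R"
      by (simp add: set_take_subset set_drop_subset)
    then have "letters (slide (take (length a) R) (drop (Suc (length a)) R) T) \<subseteq> set R \<union> letters T"
      using 4(1)[OF True] by blast
    then show ?thesis using True by auto
  next
    case False
    then show ?thesis using 4(2)[OF False] by (auto split: if_splits)
  qed
qed auto

lemma letters_insert_from: "letters (insert_from k x T) \<subseteq> insert x (letters T)"
proof (induction k x T rule: insert_from_step_induct)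
  case (append k x R T)
  then show ?case by (auto simp: insert_from_append)
next
  case (cancel k a b T)
  then show ?case using letters_slide[of a b T] by (auto simp: insert_from_cancel)
next
  case (bump k x a y b T)
  then show ?case by (auto simp: insert_from_bump)
qed simp

section \<open>Tableaux with one additional largest letter\<close>

definition rowlen :: "letter list list \<Rightarrow> nat \<Rightarrow> nat" where
  "rowlen T i = (if i < length T then length (T ! i) else 0)"

lemma rowlen_simps [simp]:
  "rowlen [] i = 0" "rowlen (R # T) 0 = length R" "rowlen (R # T) (Suc i) = rowlen T i"
  by (simp_all add: rowlen_def)

lemma rowlen_cong: "length R = length R' \<Longrightarrow> rowlen (R # T) = rowlen (R' # T)"
  by (auto simp: fun_eq_iff rowlen_def nth_Cons split: nat.splits)

lemma length_top_row: "length (top_row T) = rowlen T 0"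
  by (cases T) auto

text \<open>Shapes are compared through row lengths, which are 0 below the tableau; so a box that
  opens a new row needs no case of its own. Rows are counted from 0 here: row s is row
  \<open>Suc s\<close> of a shape.\<close>

definition grows :: "nat \<Rightarrow> letter list list \<Rightarrow> letter list list \<Rightarrow> bool" where
  "grows s T T' \<longleftrightarrow> rowlen T' = (rowlen T)(s := Suc (rowlen T s))"

lemma grows_iff: "grows s T T' \<longleftrightarrow> (\<forall>i. rowlen T' i = rowlen T i + (if i = s then 1 else 0))"
  by (auto simp: grows_def fun_eq_iff)

lemma grows_Cons [simp]:
  "length R = length R' \<Longrightarrow> grows (Suc s) (R # T) (R' # T') \<longleftrightarrow> grows s T T'"
proof -
  assume len: "length R = length R'"
  show ?thesis
    unfolding grows_iff
  proof (intro iffI allI)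
    fix i assume "\<forall>i. rowlen (R' # T') i = rowlen (R # T) i + (if i = Suc s then 1 else 0)"
    from this[rule_format, of "Suc i"] show "rowlen T' i = rowlen T i + (if i = s then 1 else 0)"
      by simp
  next
    fix i assume "\<forall>i. rowlen T' i = rowlen T i + (if i = s then 1 else 0)"
    then show "rowlen (R' # T') i = rowlen (R # T) i + (if i = Suc s then 1 else 0)"
      using len by (cases i) auto
  qed
qed

lemma grows_0 [intro]: "length R' = Suc (length R) \<Longrightarrow> grows 0 (R # T) (R' # T)"
  by (auto simp: grows_def fun_eq_iff rowlen_def nth_Cons split: nat.splits)

lemma grows_Nil [simp]: "grows 0 [] [[x]]"
  by (auto simp: grows_def fun_eq_iff rowlen_def)

text \<open>The hole counts as a box of the configuration, occupied by the placeholder h; it is the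
  box that the slide transports to a corner and removes.\<close>

lemma slide_grows: "\<exists>s. grows s (slide a b T) ((a @ h # b) # T)"
proof (induction a b T arbitrary: h rule: slide.induct)
  case (1 a)
  show ?case by (cases "a = []") (auto intro!: exI[of _ 0] grows_0)
next
  case (2 a y b)
  from 2[of y] show ?case
    using rowlen_cong[of "(a @ [y]) @ y # b" "a @ h # y # b" "[]"] by (simp add: grows_def)
next
  case (3 a R T)
  show ?case
  proof (cases "length a < length R")
    case True
    obtain s where "grows s (slide (take (length a) R) (drop (Suc (length a)) R) T) (R # T)"
      using 3[OF True, of "R ! length a"] id_take_nth_drop[OF True] by auto
    then have "grows (Suc s) (slide a [] (R # T)) ((a @ [h]) # R # T)"
      using True by simp
    then show ?thesis by blast
  qed (auto intro!: exI[of _ 0] grows_0)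
next
  case (4 a y b R T)
  show ?case
  proof (cases "length a < length R \<and> R ! length a \<le> y")
    case True
    then have len: "length a < length R" by simp
    obtain s where "grows s (slide (take (length a) R) (drop (Suc (length a)) R) T) (R # T)"
      using 4(1)[OF True, of "R ! length a"] id_take_nth_drop[OF len] by auto
    then have "grows (Suc s) (slide a (y # b) (R # T)) ((a @ h # y # b) # R # T)"
      using True by simp
    then show ?thesis by blast
  next
    case False
    then show ?thesis
      using 4(2)[OF False, of y] rowlen_cong[of "(a @ [y]) @ y # b" "a @ h # y # b" "R # T"]
      by (auto simp: grows_def)
  qed
qed

lemma insert_from_grows:
  "\<exists>s. grows s T (insert_from k x T) \<or> grows s (insert_from k x T) T"
proof (induction k x T rule: insert_from_step_induct)
  case (append k x R T)
  then show ?case by (auto simp: insert_from_append intro!: exI[of _ 0])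
next
  case (cancel k a b T)
  have "insert_from k (Plain k) ((a @ Bar k # b) # T) = slide a b T"
    using cancel by (rule insert_from_cancel)
  then show ?case
    using slide_grows[of a b T "Bar k"] by metis
next
  case (bump k x a y b T)
  then obtain s where "grows s T (insert_from (Suc k) y T) \<or> grows s (insert_from (Suc k) y T) T"
    by blast
  then have "grows (Suc s) ((a @ y # b) # T) (insert_from k x ((a @ y # b) # T)) \<or>
    grows (Suc s) (insert_from k x ((a @ y # b) # T)) ((a @ y # b) # T)"
    using bump.hyps by (auto simp: insert_from_bump)
  then show ?case by blast
qed (auto intro!: exI[of _ 0])

lemma slide_end:
  "length (top_row T) \<le> length a \<Longrightarrow> slide a b T = (if a = [] \<and> b = [] \<and> T = [] then [] else (a @ b) # T)"
  by (induction a b T rule: slide.induct) auto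

text \<open>For \<open>r = length T\<close> the letter opens a new row. The first equation does not
  look at r, hence the bound \<open>r \<le> length T\<close> that usually accompanies
  \<open>add_at\<close>.\<close>

fun add_at :: "nat \<Rightarrow> letter \<Rightarrow> letter list list \<Rightarrow> letter list list" where
  "add_at r g [] = [[g]]"
| "add_at 0 g (R # T) = (R @ [g]) # T"
| "add_at (Suc r) g (R # T) = R # add_at r g T"

lemma grows_add_at: "r \<le> length T \<Longrightarrow> grows r T (add_at r g T)"
  by (induction r g T rule: add_at.induct) auto

lemma insert_from_max:
  "(\<And>z. z \<in> letters T \<Longrightarrow> z \<le> g) \<Longrightarrow> insert_from k g T = add_at 0 g T"
  by (cases T) (auto intro: insert_from_append)

text \<open>A maximal letter at the end of the row of the hole does not influence the path. The
  entry below the hole wins ties, so g moves left only if there is nothing below the hole, and then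
  the hole leaves at the end of this row anyway.\<close>

lemma slide_add_at_0:
  assumes "\<And>z. z \<in> set b \<union> letters T \<Longrightarrow> z \<le> g"
  shows "slide a (b @ [g]) T = add_at 0 g (slide a b T)"
  using assms by (induction a b T rule: slide.induct) (auto simp: slide_end)

text \<open>The first column without \<^term>\<open>g\<close> lies immediately to the right of the first row exactly if
  every column contains \<^term>\<open>g\<close>, i.e. if each row covers with entries other than \<^term>\<open>g\<close>
  precisely the columns of the next row.\<close>

fun full :: "letter \<Rightarrow> letter list list \<Rightarrow> bool" where
  "full g [] \<longleftrightarrow> True"
| "full g (R # T) \<longleftrightarrow> length (filter (\<lambda>x. x \<noteq> g) R) = length (top_row T) \<and> full g T"

lemma filter_less_max:
  "sorted (a @ h # b) \<Longrightarrow> h < g \<Longrightarrow> filter (\<lambda>x. x \<noteq> g) a = (a :: 'a :: linorder list)"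
  by (auto simp: sorted_append filter_id_conv)

lemma filter_max:
  assumes "sorted (a @ g # b)" and "\<And>z. z \<in> set b \<Longrightarrow> z \<le> g"
  shows "filter (\<lambda>x. x \<noteq> g) (b :: 'a :: linorder list) = []"
  using assms by (fastforce simp: sorted_append filter_empty_conv)

text \<open>If e is not g, the upper row keeps its number of entries other than g, and the lower row
  keeps its length. If e is g, both numbers drop by one: by fullness nothing lies below e, so the
  slide ends in the lower row.\<close>

lemma full_down:
  assumes tab: "sp_tableau k ((a @ h # b) # R # T)" and full: "full g ((a @ h # b) # R # T)"
    and le: "\<And>z. z \<in> letters ((a @ h # b) # R # T) \<Longrightarrow> z \<le> g" and "h \<noteq> g"
    and len: "length a < length R"
    and R: "R = a' @ e # b'" "length a' = length a"
    and IH: "e \<noteq> g \<Longrightarrow> full g (slide a' b' T) \<and> length (top_row (slide a' b' T)) = length R"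
  shows "full g ((a @ e # b) # slide a' b' T)"
proof (cases "e = g")
  case False
  then show ?thesis using IH[OF False] full \<open>h \<noteq> g\<close> by simp
next
  case True
  have "filter (\<lambda>x. x \<noteq> g) b' = []"
    using tab le unfolding R by (intro filter_max[of a' g]) (auto simp: True)
  moreover have fR: "length (filter (\<lambda>x. x \<noteq> g) R) = length (top_row T)"
    using full by simp
  ultimately have "length (filter (\<lambda>x. x \<noteq> g) a') = length (top_row T)"
    by (simp add: R True)
  then have "length (top_row T) \<le> length a'"
    using length_filter_le[of "\<lambda>x. x \<noteq> g" a'] by simp
  then have "slide a' b' T = (if a' = [] \<and> b' = [] \<and> T = [] then [] else (a' @ b') # T)"
    by (rule slide_end)
  then show ?thesis
    using full \<open>h \<noteq> g\<close> fR R(2) by (auto simp: R(1) True)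
qed

text \<open>Fullness puts a box under every entry other than g, in particular under the hole. An
  entry moves left into the hole only if it is smaller than the one below the hole, so it is not g
  and again has a box below. Hence the hole must leave the top row downwards, and this row keeps its
  length.\<close>

lemma full_slide:
  assumes "sp_tableau k ((a @ h # b) # T)" and "full g ((a @ h # b) # T)"
    and "\<And>z. z \<in> letters ((a @ h # b) # T) \<Longrightarrow> z \<le> g" and "h \<noteq> g"
  shows "full g (slide a b T) \<and> length (top_row (slide a b T)) = Suc (length a + length b)"
  using assms
proof (induction a b T arbitrary: h k rule: slide.induct)
  case (1 a)
  then show ?case by simp
next
  case (2 a y b)
  then show ?case by simp
next
  case (3 a R T)
  have "h < g"
    using 3(4,5) by (simp add: order_less_le)
  then have "filter (\<lambda>x. x \<noteq> g) a = a"
    using 3(2) by (intro filter_less_max[of a h "[]"]) auto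
  then have len: "length a < length R"
    using 3(3,5) by simp
  note R = id_take_nth_drop[OF len]
  have "full g ((a @ R ! length a # []) # slide (take (length a) R) (drop (Suc (length a)) R) T)"
  proof (rule full_down[OF 3(2-5) len R])
    assume ne: "R ! length a \<noteq> g"
    show "full g (slide (take (length a) R) (drop (Suc (length a)) R) T) \<and>
      length (top_row (slide (take (length a) R) (drop (Suc (length a)) R) T)) = length R"
      using 3(1)[OF len sp_tableau_hole_down[OF 3(2) len] _ _ ne] 3(3,4) len
      unfolding R[symmetric] by auto
  qed (use len in auto)
  then show ?case using len by simp
next
  case (4 a y b R T)
  have "h < g"
    using 4(5,6) by (simp add: order_less_le)
  then have "filter (\<lambda>x. x \<noteq> g) a = a"
    using 4(3) by (intro filter_less_max[of a h "y # b"]) auto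
  then have len: "length a < length R"
    using 4(4,6) by (simp split: if_splits)
  note R = id_take_nth_drop[OF len]
  show ?case
  proof (cases "R ! length a \<le> y")
    case True
    have "full g ((a @ R ! length a # (y # b)) # slide (take (length a) R) (drop (Suc (length a)) R) T)"
    proof (rule full_down[OF 4(3-6) len R])
      assume ne: "R ! length a \<noteq> g"
      show "full g (slide (take (length a) R) (drop (Suc (length a)) R) T) \<and>
        length (top_row (slide (take (length a) R) (drop (Suc (length a)) R) T)) = length R"
        using 4(1)[OF conjI[OF len True] sp_tableau_hole_down[OF 4(3) len] _ _ ne] 4(4,5) len
        unfolding R[symmetric] by auto
    qed (use len in auto)
    then show ?thesis using len True by simp
  next
    case False
    have "R ! length a \<le> g"
      using 4(5) len by auto
    then have ne: "y \<noteq> g"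
      using False by auto
    have tab: "sp_tableau k (((a @ [y]) @ y # b) # R # T)"
      using sp_tableau_hole_right[OF 4(3)] False by auto
    then show ?thesis
      using 4(2)[OF _ tab _ _ ne] 4(4-6) ne False by auto
  qed
qed

text \<open>If g is bumped, it is appended to the next row, whose length grows together with the
  number of entries other than g above it. Any other bumped letter has a larger entry below it by
  fullness, so that the next row is again bumped rather than lengthened. As g is unbarred, a
  cancelled \<open>Bar k\<close> differs from g and \<open>full_slide\<close> applies.\<close>

lemma full_insert_from:
  assumes "sp_tableau k (R # T)" and "full g (R # T)" and "Plain k \<le> x"
    and "\<And>z. z \<in> letters (R # T) \<Longrightarrow> z \<le> g" and "\<not> barred g" and "\<exists>z\<in>set R. x < z"
  shows "full g (insert_from k x (R # T)) \<and> length (top_row (insert_from k x (R # T))) = length R"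
proof -
  have "T' \<noteq> [] \<Longrightarrow> sp_tableau k T' \<Longrightarrow> full g T' \<Longrightarrow> Plain k \<le> x \<Longrightarrow> (\<And>z. z \<in> letters T' \<Longrightarrow> z \<le> g) \<Longrightarrow>
    \<exists>z\<in>set (top_row T'). x < z \<Longrightarrow>
    full g (insert_from k x T') \<and> length (top_row (insert_from k x T')) = length (top_row T')" for T'
  proof (induction k x T' rule: insert_from_step_induct)
    case (append k x R T)
    then show ?case by (auto dest: leD)
  next
    case (cancel k a b T)
    have "Bar k \<noteq> g"
      using \<open>\<not> barred g\<close> by auto
    then show ?case
      using full_slide[OF cancel(3,4) cancel(6)] insert_from_cancel[OF cancel(1)] by auto
  next
    case (bump k x a y b T)
    have s: "sorted (a @ y # b)" and ab: "above (a @ y # b) (top_row T)"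
      using bump.prems(2) by auto
    have yg: "y \<le> g"
      using bump.prems(5) by auto
    have T: "full g T" "\<And>z. z \<in> letters T \<Longrightarrow> z \<le> g" "sp_tableau (Suc k) T"
      and count: "length (filter (\<lambda>x. x \<noteq> g) (a @ y # b)) = length (top_row T)"
      using bump.prems by auto
    have xg: "x \<noteq> g"
      using bump.hyps(2) yg by auto
    show ?case
    proof (cases "y = g")
      case True
      have "insert_from (Suc k) y T = add_at 0 g T"
        unfolding True by (rule insert_from_max[OF T(2)])
      moreover have "full g (add_at 0 g T)" "length (top_row (add_at 0 g T)) = Suc (length (top_row T))"
        using T(1) by (cases T; auto)+
      ultimately show ?thesis
        using count bump.hyps xg True by (auto simp: insert_from_bump)
    next
      case False
      then have "filter (\<lambda>x. x \<noteq> g) a = a"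
        using s yg by (intro filter_less_max) auto
      then have len: "length a < length (top_row T)"
        using count False by simp
      then have "y < top_row T ! length a"
        using ab unfolding above_def by (metis nth_append_length)
      then have ex: "\<exists>z\<in>set (top_row T). y < z"
        using len nth_mem by blast
      have "T \<noteq> []" using len by auto
      then show ?thesis
        using bump.IH[OF _ T(3,1) _ T(2) ex] Plain_Suc_le_bumped[OF bump.prems(4) bump.hyps(2,3)]
          count bump.hyps xg False by (auto simp: insert_from_bump)
    qed
  qed simp
  from this[of "R # T"] show ?thesis using assms by auto
qed

text \<open>If g is added at the end of row r, this makes the added g the rightmost one, because the
  rows from r on do not reach its column; see \<open>deletes_rightmost_add_at\<close>.\<close>

definition clear :: "letter \<Rightarrow> nat \<Rightarrow> letter list list \<Rightarrow> bool" where
  "clear g r T \<longleftrightarrow> g \<notin> letters (take r T)"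

lemma clear_simps [simp]: "clear g 0 T" "clear g (Suc r) (R # T) \<longleftrightarrow> g \<notin> set R \<and> clear g r T"
  by (simp_all add: clear_def)

text \<open>An insertion turns \<^term>\<open>T\<close> into \<^term>\<open>T'\<close>, and the additional box is in row \<^term>\<open>r\<close> before and
  in row \<^term>\<open>r'\<close> after it.  The two alternatives for a growing \<^term>\<open>T\<close> are the subcases of
  \<^const>\<open>JeuDeTaquin\<close>, those for a shrinking one are \<^const>\<open>RuleW\<close> and \<^const>\<open>RuleYa\<close>.\<close>

definition local_step :: "nat \<Rightarrow> nat \<Rightarrow> letter list list \<Rightarrow> letter list list \<Rightarrow> bool" where
  "local_step r r' T T' \<longleftrightarrow>
     (\<exists>s. grows s T T' \<and> (r' = r \<or> s = r \<and> r' = Suc r \<and> rowlen T (Suc r) = rowlen T r)) \<or>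
     (\<exists>s. grows s T' T \<and> (r' = r \<and> s \<noteq> r \<or> r' = s \<and> r = Suc s))"

section \<open>Commuting slides and insertions with the additional letter\<close>

lemma local_step_Cons:
  assumes "local_step r r' T T'" "length R = length R'"
  shows "local_step (Suc r) (Suc r') (R # T) (R' # T')"
proof -
  have gS: "grows s T T' \<Longrightarrow> grows (Suc s) (R # T) (R' # T')"
    "grows s T' T \<Longrightarrow> grows (Suc s) (R' # T') (R # T)" for s
    using assms(2) by simp_all
  show ?thesis
    using assms(1) unfolding local_step_def
  proof (elim disjE exE conjE, goal_cases)
    case (1 s)
    then show ?case using gS(1) by blast
  next
    case (2 s)
    then show ?case using gS(1)[of s] by (intro disjI1 exI[of _ "Suc s"]) auto
  next
    case (3 s)
    then show ?case using gS(2)[of s] by (intro disjI2 exI[of _ "Suc s"]) auto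
  next
    case (4 s)
    then show ?case using gS(2)[of s] by (intro disjI2 exI[of _ "Suc s"]) auto
  qed
qed

lemma local_step_grows: "grows s T T' \<Longrightarrow> local_step r r T T'"
  unfolding local_step_def by blast

lemma local_step_shrinks: "grows s T' T \<Longrightarrow> s \<noteq> r \<Longrightarrow> local_step r r T T'"
  unfolding local_step_def by blast

lemma local_step_cong: "rowlen T1 = rowlen T2 \<Longrightarrow> local_step r r' T1 T' \<longleftrightarrow> local_step r r' T2 T'"
  by (simp add: local_step_def grows_def)

text \<open>The critical configuration: the additional g lies directly below the hole, and only
  copies of g stand to the right of the hole. With the additional g, it moves up and the hole leaves
  the lower row; without it, the hole leaves at the end of the upper row. As b consists of copies of
  g, the results differ by a g at the end of the upper row. So the additional box rises by one row,
  as in \<open>RuleYa\<close>.\<close>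

lemma slide_add_under_hole:
  assumes tab: "sp_tableau k ((a @ h # b) # T)" and tab': "sp_tableau k ((a @ h # b) # add_at 0 g T)"
    and len: "length a = length (top_row T)"
    and le: "\<And>z. z \<in> letters ((a @ h # b) # T) \<Longrightarrow> z \<le> g" and b: "set b \<subseteq> {g}"
  shows "slide a b (add_at 0 g T) = add_at 0 g (slide a b T)"
    and "full g T \<Longrightarrow> full g (slide a b T)" and "grows 0 (slide a b T) ((a @ h # b) # T)"
proof -
  have slide: "slide a b T = (if a = [] \<and> b = [] \<and> T = [] then [] else (a @ b) # T)"
    using len by (intro slide_end) simp
  have bg: "b @ [g] = g # b"
    using b by (induction b) auto
  have aT: "a = [] \<longleftrightarrow> T = []"
    using tab len by (cases T) auto
  show "slide a b (add_at 0 g T) = add_at 0 g (slide a b T)"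
  proof (cases T)
    case Nil
    then show ?thesis using slide aT b bg by (cases b) (auto simp: slide_end)
  next
    case (Cons R T1)
    have T1: "length (top_row T1) \<le> length R" "R \<noteq> []"
      using tab Cons by (auto simp: above_def)
    then show ?thesis using slide aT b bg len Cons by (cases b) (auto simp: slide_end)
  qed
  show "grows 0 (slide a b T) ((a @ h # b) # T)"
    using slide by (auto intro!: grows_0)
  assume full: "full g T"
  have "z < g" if z: "z \<in> set a" for z
  proof -
    obtain i where i: "i < length a" "z = a ! i"
      using z by (auto simp: in_set_conv_nth)
    have "above (a @ h # b) (top_row T)"
      using tab by simp
    then have "(a @ h # b) ! i < top_row T ! i"
      using i len by (simp add: above_def)
    moreover have "top_row T ! i \<le> g"
      using le i len by (cases T) auto
    ultimately show ?thesis using i by (simp add: nth_append)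
  qed
  then have "filter (\<lambda>x. x \<noteq> g) a = a" "filter (\<lambda>x. x \<noteq> g) b = []"
    using b by (auto simp: filter_id_conv filter_empty_conv)
  then show "full g (slide a b T)"
    using full slide len by simp
qed

lemma slide_add_at_right:
  assumes "\<exists>r'\<le>length T'.
      U = add_at r' g T' \<and>
      (full g (drop r T) \<longrightarrow> full g (drop r' T') \<and> local_step (Suc r) r' (((a @ [y]) @ y # b) # T) T') \<and>
      (clear g (Suc r) (((a @ [y]) @ y # b) # T) \<longrightarrow> clear g r' T')"
  shows "\<exists>r'\<le>length T'.
      U = add_at r' g T' \<and>
      (full g (drop r T) \<longrightarrow> full g (drop r' T') \<and> local_step (Suc r) r' ((a @ h # y # b) # T) T') \<and>
      (clear g (Suc r) ((a @ h # y # b) # T) \<longrightarrow> clear g r' T')"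
proof -
  have "rowlen (((a @ [y]) @ y # b) # T) = rowlen ((a @ h # y # b) # T)"
    by (intro rowlen_cong) simp
  from local_step_cong[OF this] assms show ?thesis by auto
qed

lemma slide_add_at_stop:
  assumes "r \<le> length T"
  shows "\<exists>r'\<le>length (a # T).
      a # add_at r g T = add_at r' g (a # T) \<and>
      (full g (drop r T) \<longrightarrow> full g (drop r' (a # T)) \<and> local_step (Suc r) r' ((a @ [h]) # T) (a # T)) \<and>
      (clear g (Suc r) ((a @ [h]) # T) \<longrightarrow> clear g r' (a # T))"
  using assms by (intro exI[of _ "Suc r"]) (auto intro!: local_step_shrinks[of 0] grows_0)

lemma slide_add_at_down:
  assumes tab: "sp_tableau k ((a @ h # b) # R # T)" and tab': "sp_tableau k ((a @ h # b) # add_at r g (R # T))"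
    and le: "\<And>z. z \<in> letters ((a @ h # b) # R # T) \<Longrightarrow> z \<le> g" and r: "r \<le> length (R # T)"
    and R: "R = a' @ e # b'" "length a' = length a"
    and eb: "\<And>y b1. b = y # b1 \<Longrightarrow> e \<le> y"
    and IH: "\<And>r. r \<le> length T \<Longrightarrow> sp_tableau (Suc k) (R # add_at r g T) \<Longrightarrow> \<exists>r'\<le>length (slide a' b' T).
      slide a' b' (add_at r g T) = add_at r' g (slide a' b' T) \<and>
      (full g (drop r T) \<longrightarrow> full g (drop r' (slide a' b' T)) \<and>
        local_step (Suc r) r' (R # T) (slide a' b' T)) \<and>
      (clear g (Suc r) (R # T) \<longrightarrow> clear g r' (slide a' b' T))"
    and U: "slide a b (add_at r g (R # T)) = (a @ e # b) # (if r = 0 then slide a' (b' @ [g]) T else slide a' b' (add_at (r - 1) g T))"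
    and S: "slide a b (R # T) = (a @ e # b) # slide a' b' T"
  shows "\<exists>r'\<le>length (slide a b (R # T)).
      slide a b (add_at r g (R # T)) = add_at r' g (slide a b (R # T)) \<and>
      (full g (drop r (R # T)) \<longrightarrow> full g (drop r' (slide a b (R # T))) \<and>
        local_step (Suc r) r' ((a @ h # b) # R # T) (slide a b (R # T))) \<and>
      (clear g (Suc r) ((a @ h # b) # R # T) \<longrightarrow> clear g r' (slide a b (R # T)))"
proof (cases r)
  case 0
  have tab2: "sp_tableau (Suc k) ((a' @ e # b') # T)"
    using tab R by simp
  have "above (a @ h # b) (R @ [g])"
    using tab' 0 by simp
  then have len: "length R < Suc (length a + length b)"
    and lt: "\<And>i. i < Suc (length R) \<Longrightarrow> (a @ h # b) ! i < (R @ [g]) ! i"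
    by (auto simp: above_def)
  \<comment> \<open>The row R with its additional g still fits under the upper row, so the hole has
    a right neighbour y, and the letter below y, possibly the additional g, is larger than y. Hence
    the letter e that moves up is smaller than g, and the upper row receives no g.\<close>
  then obtain y b1 where b: "b = y # b1"
    using R by (cases b) auto
  have "y < (R @ [g]) ! Suc (length a)"
    using lt[of "Suc (length a)"] R by (simp add: b nth_append)
  also have "\<dots> \<le> g"
  proof -
    have "(R @ [g]) ! Suc (length a) \<in> set (R @ [g])"
      using R by (intro nth_mem) simp
    then show ?thesis using le by auto
  qed
  finally have "e < g"
    using eb b by (auto intro: le_less_trans)
  have "slide a' (b' @ [g]) T = add_at 0 g (slide a' b' T)"
    using le R by (intro slide_add_at_0) auto
  moreover have "full g (slide a' b' T) \<and> local_step 1 1 ((a @ h # b) # R # T) (slide a b (R # T))"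
    if "full g (R # T)"
  proof -
    have "full g (slide a' b' T) \<and> length (top_row (slide a' b' T)) = Suc (length a' + length b')"
      using tab2 that le \<open>e < g\<close> R by (intro full_slide) auto
    moreover obtain s where s: "grows s (slide a' b' T) (R # T)"
      using slide_grows R(1) by blast
    moreover from s have "rowlen (R # T) 0 = rowlen (slide a' b' T) 0 + (if 0 = s then 1 else 0)"
      unfolding grows_iff by blast
    ultimately have "full g (slide a' b' T)" "s \<noteq> 0"
      using R(1) by (auto simp: length_top_row split: if_splits)
    moreover have "grows (Suc s) (slide a b (R # T)) ((a @ h # b) # R # T)"
      using s by (simp add: S)
    ultimately show ?thesis
      using local_step_shrinks[of "Suc s"] by auto
  qed
  ultimately show ?thesis
    using U S 0 \<open>e < g\<close> by (intro exI[of _ 1]) auto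
next
  case (Suc r1)
  have r1: "r1 \<le> length T" "sp_tableau (Suc k) (R # add_at r1 g T)"
    using r tab' Suc by auto
  from IH[OF this] obtain r' where r': "r' \<le> length (slide a' b' T)"
    "slide a' b' (add_at r1 g T) = add_at r' g (slide a' b' T)"
    "full g (drop r1 T) \<Longrightarrow> full g (drop r' (slide a' b' T))"
    "full g (drop r1 T) \<Longrightarrow> local_step (Suc r1) r' (R # T) (slide a' b' T)"
    "clear g (Suc r1) (R # T) \<Longrightarrow> clear g r' (slide a' b' T)"
    by blast
  show ?thesis
    using r' U S Suc local_step_Cons[OF r'(4), of "a @ h # b" "a @ e # b"] R(1)
    by (intro exI[of _ "Suc r'"]) auto
qed

text \<open>The additional box changes the path of the hole only in the critical configuration,
  which \<open>special\<close> settles. Row r of T is row \<open>Suc r\<close> of the whole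
  configuration; this is the shift in \<open>local_step\<close> and \<open>clear\<close>.\<close>

lemma slide_add_at:
  assumes "sp_tableau k ((a @ h # b) # T)" and "sp_tableau k ((a @ h # b) # add_at r g T)"
    and "\<And>z. z \<in> letters ((a @ h # b) # T) \<Longrightarrow> z \<le> g" and "r \<le> length T"
  shows "\<exists>r'\<le>length (slide a b T).
    slide a b (add_at r g T) = add_at r' g (slide a b T) \<and>
    (full g (drop r T) \<longrightarrow> full g (drop r' (slide a b T)) \<and>
      local_step (Suc r) r' ((a @ h # b) # T) (slide a b T)) \<and>
    (clear g (Suc r) ((a @ h # b) # T) \<longrightarrow> clear g r' (slide a b T))"
proof -
  have special: "\<exists>r'\<le>length (slide a b T).
    slide a b (add_at 0 g T) = add_at r' g (slide a b T) \<and>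
    (full g (drop 0 T) \<longrightarrow> full g (drop r' (slide a b T)) \<and>
      local_step (Suc 0) r' ((a @ h # b) # T) (slide a b T)) \<and>
    (clear g (Suc 0) ((a @ h # b) # T) \<longrightarrow> clear g r' (slide a b T))"
    if "sp_tableau k ((a @ h # b) # T)" and "sp_tableau k ((a @ h # b) # add_at 0 g T)"
      and "\<And>z. z \<in> letters ((a @ h # b) # T) \<Longrightarrow> z \<le> g" and "length a = length (top_row T)" and "set b \<subseteq> {g}"
    for k a h b T
  proof -
    have *: "slide a b (add_at 0 g T) = add_at 0 g (slide a b T)"
      "full g T \<Longrightarrow> full g (slide a b T)" "grows 0 (slide a b T) ((a @ h # b) # T)"
      using that(3) by (auto intro!: slide_add_under_hole[OF that(1,2,4) _ that(5)])
    have "local_step (Suc 0) 0 ((a @ h # b) # T) (slide a b T)"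
      unfolding local_step_def using *(3) by (intro disjI2 exI[of _ 0]) simp
    then show ?thesis using *(1,2) by (intro exI[of _ 0]) simp
  qed
  have only_max: "set (y # b) \<subseteq> {g}" if "sorted (a @ h # y # b)" "g \<le> y"
    "\<And>z. z \<in> set (a @ h # y # b) \<Longrightarrow> z \<le> g" for a b h y
  proof -
    have "g \<le> z" if z: "z \<in> set (y # b)" for z
      using z \<open>sorted (a @ h # y # b)\<close> \<open>g \<le> y\<close> order_trans by (auto simp: sorted_append)
    then show ?thesis
      using that(3) by (auto intro: antisym)
  qed
  show ?thesis
    using assms
  proof (induction a b T arbitrary: h k r rule: slide.induct)
    case (1 a)
    show ?case
    proof (cases "a = []")
      case True
      then have "r = 0" using 1(4) by simp
      show ?thesis unfolding \<open>r = 0\<close>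
        by (rule special[OF 1(1)]) (use 1(2,3) True \<open>r = 0\<close> in simp_all)
    next
      case False
      then show ?thesis using slide_add_at_stop[where r = r and T = "[]" and a = a and g = g and h = h] 1 by (auto simp: slide_end Suc_le_eq)
    qed
  next
    case (2 a y b)
    show ?case
    \<comment> \<open>With no rows below, the additional letter forms a row of its own, so it lies
      under the hole only if the hole is in the first column.\<close>
    proof (cases "a = [] \<and> g \<le> y")
      case True
      have "set (y # b) \<subseteq> {g}"
        using 2(2,4) True by (intro only_max[of a h]) auto
      have "r = 0" using 2(5) by simp
      show ?thesis unfolding \<open>r = 0\<close>
        by (rule special[OF 2(2) _ 2(4)]) (use 2(3) True \<open>set (y # b) \<subseteq> {g}\<close> \<open>r = 0\<close> in \<open>simp_all\<close>)
    next
      case False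
      have tab: "sp_tableau k (((a @ [y]) @ y # b) # [])"
        using sp_tableau_hole_right[OF 2(2)] by simp
      have tab': "sp_tableau k (((a @ [y]) @ y # b) # add_at r g [])"
        using sp_tableau_hole_right[OF 2(3)] False by auto
      have le: "z \<le> g" if "z \<in> letters [(a @ [y]) @ y # b]" for z
        using 2(4) that by auto
      have "slide a (y # b) (add_at r g []) = slide (a @ [y]) b (add_at r g [])"
        using False by auto
      then show ?thesis
        using slide_add_at_right[OF 2(1)[OF tab tab' le 2(5)]] by simp
    qed
  next
    case (3 a R T)
    show ?case
    proof (cases "length a < length R")
      case True
      note R = id_take_nth_drop[OF True]
      have tabR: "sp_tableau (Suc k) (R # T)" and leR: "\<And>z. z \<in> letters (R # T) \<Longrightarrow> z \<le> g"
        using "3.prems"(1,3) by auto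
      note IH = "3.IH"[OF True, where h = "R ! length a" and k = "Suc k", unfolded R[symmetric],
        OF tabR _ leR]
      show ?thesis
      proof (rule slide_add_at_down[OF 3(2,3) _ 3(5) R])
        show "z \<le> g" if "z \<in> letters ((a @ h # []) # R # T)" for z
          by (rule "3.prems"(3)[OF that])
        show "R ! length a \<le> y'" if "[] = y' # b1" for y' b1
          using that True by simp
        show "\<exists>r'\<le>length (slide (take (length a) R) (drop (Suc (length a)) R) T).
          slide (take (length a) R) (drop (Suc (length a)) R) (add_at r g T) =
            add_at r' g (slide (take (length a) R) (drop (Suc (length a)) R) T) \<and>
          (full g (drop r T) \<longrightarrow>
            full g (drop r' (slide (take (length a) R) (drop (Suc (length a)) R) T)) \<and>
            local_step (Suc r) r' (R # T) (slide (take (length a) R) (drop (Suc (length a)) R) T)) \<and>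
          (clear g (Suc r) (R # T) \<longrightarrow>
            clear g r' (slide (take (length a) R) (drop (Suc (length a)) R) T))"
          if "r \<le> length T" "sp_tableau (Suc k) (R # add_at r g T)" for r
          by (rule IH[OF that(2) _ that(1)])
        show "length (take (length a) R) = length a"
          using True by simp
        show "slide a ([]) (R # T) = (a @ R ! length a # []) # slide (take (length a) R) (drop (Suc (length a)) R) T"
          using True by simp
        show "slide a ([]) (add_at r g (R # T)) = (a @ R ! length a # []) #
          (if r = 0 then slide (take (length a) R) (drop (Suc (length a)) R @ [g]) T
           else slide (take (length a) R) (drop (Suc (length a)) R) (add_at (r - 1) g T))"
          using True by (cases r) (simp_all add: nth_append)
      qed
    next
      case False
      show ?thesis
      proof (cases "r = 0 \<and> length a = length R")
        case True
        then have "r = 0" by simp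
        show ?thesis unfolding \<open>r = 0\<close>
          by (rule special[OF 3(2) _ 3(4)]) (use 3(3) True in simp_all)
      next
        case F: False
        have "slide a [] (add_at r g (R # T)) = a # add_at r g (R # T)"
          using False F by (cases r) auto
        moreover have "slide a [] (R # T) = a # R # T"
          using False by simp
        ultimately show ?thesis
          using slide_add_at_stop[OF 3(5), where a = a and g = g and h = h] by simp
      qed
    qed
  next
    case (4 a y b R T)
    show ?case
    proof (cases "length a < length R \<and> R ! length a \<le> y")
      case True
      then have len: "length a < length R" by simp
      note R = id_take_nth_drop[OF len]
      have tabR: "sp_tableau (Suc k) (R # T)" and leR: "\<And>z. z \<in> letters (R # T) \<Longrightarrow> z \<le> g"
        using "4.prems"(1,3) by auto
      note IH = "4.IH"(1)[OF True, where h = "R ! length a" and k = "Suc k", unfolded R[symmetric],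
        OF tabR _ leR]
      show ?thesis
      proof (rule slide_add_at_down[OF 4(3,4) _ 4(6) R])
        show "z \<le> g" if "z \<in> letters ((a @ h # y # b) # R # T)" for z
          by (rule "4.prems"(3)[OF that])
        show "R ! length a \<le> y'" if "y # b = y' # b1" for y' b1
          using that True by simp
        show "\<exists>r'\<le>length (slide (take (length a) R) (drop (Suc (length a)) R) T).
          slide (take (length a) R) (drop (Suc (length a)) R) (add_at r g T) =
            add_at r' g (slide (take (length a) R) (drop (Suc (length a)) R) T) \<and>
          (full g (drop r T) \<longrightarrow>
            full g (drop r' (slide (take (length a) R) (drop (Suc (length a)) R) T)) \<and>
            local_step (Suc r) r' (R # T) (slide (take (length a) R) (drop (Suc (length a)) R) T)) \<and>
          (clear g (Suc r) (R # T) \<longrightarrow>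
            clear g r' (slide (take (length a) R) (drop (Suc (length a)) R) T))"
          if "r \<le> length T" "sp_tableau (Suc k) (R # add_at r g T)" for r
          by (rule IH[OF that(2) _ that(1)])
        show "length (take (length a) R) = length a"
          using len by simp
        show "slide a (y # b) (R # T) = (a @ R ! length a # y # b) # slide (take (length a) R) (drop (Suc (length a)) R) T"
          using True by simp
        show "slide a (y # b) (add_at r g (R # T)) = (a @ R ! length a # y # b) #
          (if r = 0 then slide (take (length a) R) (drop (Suc (length a)) R @ [g]) T
           else slide (take (length a) R) (drop (Suc (length a)) R) (add_at (r - 1) g T))"
          using True by (cases r) (simp_all add: nth_append)
      qed
    next
      case False
      show ?thesis
      \<comment> \<open>Here the additional g changes the decision: it is the entry below the hole
        and wins the tie against a right neighbour equal to g.\<close>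
      proof (cases "r = 0 \<and> length a = length R \<and> g \<le> y")
        case True
        have "set (y # b) \<subseteq> {g}"
          using 4(3,5) True by (intro only_max[of a h]) auto
        have "r = 0" using True by simp
        show ?thesis unfolding \<open>r = 0\<close>
          by (rule special[OF 4(3) _ 4(5)]) (use 4(4) True \<open>set (y # b) \<subseteq> {g}\<close> in simp_all)
      next
        case F: False
        have tab: "sp_tableau k (((a @ [y]) @ y # b) # R # T)"
          using sp_tableau_hole_right[OF 4(3)] False by auto
        have "\<not> (length a < length (top_row (add_at r g (R # T))) \<and> top_row (add_at r g (R # T)) ! length a \<le> y)"
          using False F by (cases r) (auto simp: nth_append less_Suc_eq)
        then have lt: "length a < length (top_row (add_at r g (R # T))) \<Longrightarrow> y < top_row (add_at r g (R # T)) ! length a"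
          and U: "slide a (y # b) (add_at r g (R # T)) = slide (a @ [y]) b (add_at r g (R # T))"
          by (cases r; auto)+
        have tab': "sp_tableau k (((a @ [y]) @ y # b) # add_at r g (R # T))"
          using sp_tableau_hole_right[OF 4(4)] lt by auto
        have le: "z \<le> g" if "z \<in> letters (((a @ [y]) @ y # b) # R # T)" for z
          using 4(5) that by auto
        have S: "slide a (y # b) (R # T) = slide (a @ [y]) b (R # T)"
          using False by auto
        show ?thesis
          using slide_add_at_right[OF 4(2)[OF False tab tab' le 4(6)]] unfolding U S .
      qed
    qed
  qed
qed

text \<open>Suppose that x arrives in the row of the additional g. If x = g is appended, the
  additional box moves one column to the right: a horizontal domino. If x < g is appended in T, it
  bumps the additional g in the other tableau, and by fullness the next row ends in the same column,
  so g lands directly below: a vertical domino. If x bumps or cancels a letter of T, the shape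
  changes in lower rows only (for a cancellation by fullness), and the additional box stays.\<close>

lemma insert_from_add_at_full:
  assumes "sp_tableau k T" and "sp_tableau k (add_at r g T)" and "r \<le> length T"
    and "Plain k \<le> x" and "x \<le> g" and "\<not> barred g" and "\<And>z. z \<in> letters T \<Longrightarrow> z \<le> g"
    and "full g (drop r T)"
  shows "\<exists>r'\<le>length (insert_from k x T).
    insert_from k x (add_at r g T) = add_at r' g (insert_from k x T) \<and>
    full g (drop r' (insert_from k x T)) \<and> local_step r r' T (insert_from k x T)"
  using assms
proof (induction k x T arbitrary: r rule: insert_from_step_induct)
  case (Nil k x)
  then have "r = 0" by simp
  show ?case
  proof (cases "x = g")
    case True
    then show ?thesis
      using \<open>r = 0\<close> insert_from_append[of "[g]" g k "[]"]
      by (intro exI[of _ 0]) (auto intro!: local_step_grows[of 0])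
  next
    case False
    then have "insert_from k x (([] @ g # []) # []) = [[x], [g]]"
      using Nil by (subst insert_from_bump) auto
    moreover have "local_step 0 (Suc 0) [] [[x]]"
      by (auto simp: local_step_def intro!: exI[of _ 0])
    ultimately show ?thesis
      using \<open>r = 0\<close> by (intro exI[of _ 1]) simp
  qed
next
  case (append k x R T)
  have T2: "insert_from k x (R # T) = (R @ [x]) # T"
    using append.hyps by (rule insert_from_append)
  have grows: "grows 0 (R # T) ((R @ [x]) # T)"
    by (rule grows_0) simp
  show ?case
  proof (cases r)
    case 0
    show ?thesis
    proof (cases "x = g")
      case True
      then have "insert_from k x (add_at r g (R # T)) = (R @ [g, g]) # T"
        using append.hyps 0 insert_from_append[of "R @ [g]" x k T] by auto
      then show ?thesis
        using T2 True 0 append.prems(8) local_step_grows[OF grows] by (intro exI[of _ 0]) simp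
    next
      case False
      then have "x < g"
        using append.prems(5) by simp
      then have "insert_from k x ((R @ g # []) # T) = (R @ [x]) # insert_from (Suc k) g T"
        using append.prems(6) append.hyps by (subst insert_from_bump) auto
      also have "insert_from (Suc k) g T = add_at 0 g T"
        using append.prems(7) by (intro insert_from_max) auto
      finally have U2: "insert_from k x (add_at r g (R # T)) = add_at 1 g ((R @ [x]) # T)"
        using 0 by simp
      have "g \<notin> set R"
        using append.hyps \<open>x < g\<close> by (meson leD)
      then have "filter (\<lambda>x. x \<noteq> g) R = R"
        by (auto simp: filter_id_conv)
      then have "rowlen (R # T) (Suc 0) = rowlen (R # T) 0"
        using append.prems(8) 0 by (simp add: length_top_row)
      then have "local_step r 1 (R # T) ((R @ [x]) # T)"
        using grows 0 by (auto simp: local_step_def)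
      then show ?thesis
        using U2 T2 0 append.prems(8) by (intro exI[of _ 1]) simp
    qed
  next
    case (Suc r1)
    have "insert_from k x (add_at r g (R # T)) = (R @ [x]) # add_at r1 g T"
      using append.hyps by (simp add: Suc insert_from_append)
    then show ?thesis
      using T2 Suc append.prems(3,8) local_step_grows[OF grows] by (intro exI[of _ r]) simp
  qed
next
  case (cancel k a b T)
  have T2: "insert_from k (Plain k) ((a @ Bar k # b) # T) = slide a b T"
    using cancel.hyps by (rule insert_from_cancel)
  show ?case
  proof (cases r)
    case 0
    have U2: "insert_from k (Plain k) ((a @ Bar k # (b @ [g])) # T) = slide a (b @ [g]) T"
      using cancel.hyps by (rule insert_from_cancel)
    have "slide a (b @ [g]) T = add_at 0 g (slide a b T)"
      using cancel.prems(7) by (intro slide_add_at_0) auto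
    moreover have "Bar k \<noteq> g"
      using cancel.prems(6) by auto
    then have f: "full g (slide a b T) \<and> length (top_row (slide a b T)) = Suc (length a + length b)"
      using cancel.prems(7,8) 0 by (intro full_slide[OF cancel.prems(1)]) auto
    moreover obtain s where s: "grows s (slide a b T) ((a @ Bar k # b) # T)"
      using slide_grows by blast
    then have "rowlen ((a @ Bar k # b) # T) 0 = rowlen (slide a b T) 0 + (if 0 = s then 1 else 0)"
      unfolding grows_iff by blast
    then have "s \<noteq> 0"
      using f by (auto simp: length_top_row split: if_splits)
    then have "local_step 0 0 ((a @ Bar k # b) # T) (slide a b T)"
      by (rule local_step_shrinks[OF s])
    ultimately show ?thesis
      unfolding T2 using U2 0 by (intro exI[of _ 0]) simp
  next
    case (Suc r1)
    have "\<exists>r'\<le>length (slide a b T).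
      slide a b (add_at r1 g T) = add_at r' g (slide a b T) \<and>
      (full g (drop r1 T) \<longrightarrow> full g (drop r' (slide a b T)) \<and>
        local_step (Suc r1) r' ((a @ Bar k # b) # T) (slide a b T)) \<and>
      (clear g (Suc r1) ((a @ Bar k # b) # T) \<longrightarrow> clear g r' (slide a b T))"
      using cancel.prems(2,3,7) Suc by (intro slide_add_at[OF cancel.prems(1)]) simp_all
    moreover have "insert_from k (Plain k) ((a @ Bar k # b) # add_at r1 g T) = slide a b (add_at r1 g T)"
      using cancel.hyps by (rule insert_from_cancel)
    ultimately show ?thesis
      using T2 Suc cancel.prems(8) by auto
  qed
next
  case (bump k x a y b T)
  have T2: "insert_from k x ((a @ y # b) # T) = (a @ x # b) # insert_from (Suc k) y T"
    using bump.hyps by (subst insert_from_bump) auto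
  have y: "Plain (Suc k) \<le> y" "y \<le> g"
    using Plain_Suc_le_bumped[OF bump.prems(4) bump.hyps(2,3)] bump.prems(7) by auto
  show ?case
  proof (cases r)
    case 0
    have "insert_from k x ((a @ y # (b @ [g])) # T) = (a @ x # (b @ [g])) # insert_from (Suc k) y T"
      using bump.hyps by (subst insert_from_bump) auto
    moreover have "full g (insert_from k x ((a @ y # b) # T)) \<and>
      length (top_row (insert_from k x ((a @ y # b) # T))) = length (a @ y # b)"
      using bump.prems(4-8) bump.hyps(2) 0 by (intro full_insert_from[OF bump.prems(1)]) auto
    moreover obtain s where "grows s T (insert_from (Suc k) y T) \<or> grows s (insert_from (Suc k) y T) T"
      using insert_from_grows by blast
    then have "local_step 0 0 ((a @ y # b) # T) ((a @ x # b) # insert_from (Suc k) y T)"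
      by (auto intro: local_step_grows[of "Suc s"] local_step_shrinks[of "Suc s"])
    ultimately show ?thesis
      using 0 unfolding T2 by (intro exI[of _ 0]) auto
  next
    case (Suc r1)
    have "insert_from k x ((a @ y # b) # add_at r1 g T) = (a @ x # b) # insert_from (Suc k) y (add_at r1 g T)"
      using bump.hyps by (subst insert_from_bump) auto
    moreover have "\<exists>r'\<le>length (insert_from (Suc k) y T).
      insert_from (Suc k) y (add_at r1 g T) = add_at r' g (insert_from (Suc k) y T) \<and>
      full g (drop r' (insert_from (Suc k) y T)) \<and> local_step r1 r' T (insert_from (Suc k) y T)"
      using bump.prems Suc y by (intro bump.IH) auto
    then obtain r' where r': "r' \<le> length (insert_from (Suc k) y T)"
      "insert_from (Suc k) y (add_at r1 g T) = add_at r' g (insert_from (Suc k) y T)"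
      "full g (drop r' (insert_from (Suc k) y T))" "local_step r1 r' T (insert_from (Suc k) y T)"
      by blast
    ultimately show ?thesis
      using Suc T2 local_step_Cons[OF r'(4), of "a @ y # b" "a @ x # b"]
      by (intro exI[of _ "Suc r'"]) simp
  qed
qed

text \<open>Now g may be barred, and the second alternative is the cancellation of the additional
  letter in row \<open>r' + k\<close>. It happens only if the cancelling letter would be appended to
  this row in T: a \<open>Bar k\<close> of T itself in that row would be met first and be cancelled
  in both tableaux.\<close>

lemma insert_from_add_at_clear:
  assumes "sp_tableau k T" and "sp_tableau k (add_at r g T)" and "r \<le> length T"
    and "Plain k \<le> x" and "x < g" and "\<And>z. z \<in> letters T \<Longrightarrow> z \<le> g" and "clear g r T"
  shows "(\<exists>r'\<le>length (insert_from k x T).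
      insert_from k x (add_at r g T) = add_at r' g (insert_from k x T) \<and> clear g r' (insert_from k x T)) \<or>
    (\<exists>r'\<le>length (insert_from k x (add_at r g T)).
      g = Bar (r' + k) \<and> g \<notin> letters (insert_from k x (add_at r g T)) \<and>
      insert_from k x T = add_at r' (Plain (r' + k)) (insert_from k x (add_at r g T)) \<and>
      full (Plain (r' + k)) (drop r' (insert_from k x (add_at r g T))) \<and>
      grows r' (insert_from k x (add_at r g T)) (add_at r g T))"
  using assms
proof (induction k x T arbitrary: r rule: insert_from_step_induct)
  case (Nil k x)
  then have "r = 0" by simp
  show ?case
  proof (cases "x = Plain k \<and> g = Bar k")
    case True
    then have "insert_from k x (([] @ g # []) # []) = []"
      using Nil.prems(5) by (subst insert_from_bump) auto
    then show ?thesis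
      using \<open>r = 0\<close> True by (intro disjI2 exI[of _ 0]) simp
  next
    case False
    then have "insert_from k x (([] @ g # []) # []) = [[x], [g]]"
      using Nil.prems(5) by (subst insert_from_bump) auto
    then show ?thesis
      using \<open>r = 0\<close> Nil.prems(5) by (intro disjI1 exI[of _ 1]) simp
  qed
next
  case (append k x R T)
  have T2: "insert_from k x (R # T) = (R @ [x]) # T"
    using append.hyps by (rule insert_from_append)
  have gR: "g \<notin> set R"
    using append.hyps append.prems(5) by (auto dest: leD)
  show ?case
  proof (cases r)
    case 0
    show ?thesis
    proof (cases "x = Plain k \<and> g = Bar k")
      case True
      \<comment> \<open>No letter of R exceeds \<open>Plain k\<close>, so the row bound makes all of
        them \<open>Plain k\<close>; a lower row would need letters beyond \<open>g = Bar k\<close>.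
        Thus R is the last row, and each of its columns contains \<open>Plain k\<close>, which is
        fullness.\<close>
      have R: "\<forall>z\<in>set R. z = Plain k" "R \<noteq> []"
        using append.prems(1) append.hyps True by (auto intro: antisym)
      have "T = []"
      proof (rule ccontr)
        assume "T \<noteq> []"
        then obtain S T1 where T: "T = S # T1"
          by (cases T) auto
        then have "hd S \<in> set S" "Plain (Suc k) \<le> hd S"
          using append.prems(1) by auto
        then show False
          using append.prems(6)[of "hd S"] True T by (auto simp: Plain_Suc_le_iff dest: leD)
      qed
      have "insert_from k x ((R @ g # []) # T) = slide R [] T"
        using append.hyps True by (subst insert_from_bump) (auto simp: less_letter_def)
      then have "insert_from k x (add_at r g (R # T)) = [R]"
        using 0 \<open>T = []\<close> R by simp
      moreover have "full (Plain k) [R]"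
        using R by (auto simp: filter_empty_conv)
      ultimately show ?thesis
        using T2 True 0 \<open>T = []\<close> gR by (intro disjI2 exI[of _ 0]) (auto intro!: grows_0)
    next
      case False
      then have "insert_from k x ((R @ g # []) # T) = (R @ [x]) # insert_from (Suc k) g T"
        using append.prems(5) append.hyps by (subst insert_from_bump) auto
      also have "insert_from (Suc k) g T = add_at 0 g T"
        using append.prems(6) by (intro insert_from_max) auto
      finally show ?thesis
        using 0 T2 gR append.prems(5) by (intro disjI1 exI[of _ 1]) auto
    qed
  next
    case (Suc r1)
    have "insert_from k x (add_at r g (R # T)) = (R @ [x]) # add_at r1 g T"
      using append.hyps by (simp add: Suc insert_from_append)
    then show ?thesis
      using T2 Suc append.prems(3,5,7) by (intro disjI1 exI[of _ r]) auto
  qed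
next
  case (cancel k a b T)
  have T2: "insert_from k (Plain k) ((a @ Bar k # b) # T) = slide a b T"
    using cancel.hyps by (rule insert_from_cancel)
  show ?case
  proof (cases r)
    case 0
    have "insert_from k (Plain k) ((a @ Bar k # (b @ [g])) # T) = slide a (b @ [g]) T"
      using cancel.hyps by (rule insert_from_cancel)
    moreover have "slide a (b @ [g]) T = add_at 0 g (slide a b T)"
      using cancel.prems(6) by (intro slide_add_at_0) auto
    ultimately show ?thesis
      unfolding T2 using 0 by (intro disjI1 exI[of _ 0]) simp
  next
    case (Suc r1)
    have "\<exists>r'\<le>length (slide a b T).
      slide a b (add_at r1 g T) = add_at r' g (slide a b T) \<and>
      (full g (drop r1 T) \<longrightarrow> full g (drop r' (slide a b T)) \<and>
        local_step (Suc r1) r' ((a @ Bar k # b) # T) (slide a b T)) \<and>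
      (clear g (Suc r1) ((a @ Bar k # b) # T) \<longrightarrow> clear g r' (slide a b T))"
      using cancel.prems(2,3,6) Suc by (intro slide_add_at[OF cancel.prems(1)]) simp_all
    moreover have "insert_from k (Plain k) ((a @ Bar k # b) # add_at r1 g T) = slide a b (add_at r1 g T)"
      using cancel.hyps by (rule insert_from_cancel)
    ultimately show ?thesis
      using T2 Suc cancel.prems(7) by auto
  qed
next
  case (bump k x a y b T)
  have T2: "insert_from k x ((a @ y # b) # T) = (a @ x # b) # insert_from (Suc k) y T"
    using bump.hyps by (subst insert_from_bump) auto
  show ?case
  proof (cases r)
    case 0
    have "insert_from k x ((a @ y # (b @ [g])) # T) = (a @ x # (b @ [g])) # insert_from (Suc k) y T"
      using bump.hyps by (subst insert_from_bump) auto
    then show ?thesis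
      using 0 unfolding T2 by (intro disjI1 exI[of _ 0]) auto
  next
    case (Suc r1)
    let ?U = "insert_from (Suc k) y (add_at r1 g T)" and ?T = "insert_from (Suc k) y T"
    have g: "g \<notin> set (a @ x # b)" "y \<noteq> g" "y \<le> g" "clear g r1 T"
      using bump.prems(5-7) Suc by auto
    have "insert_from k x ((a @ y # b) # add_at r1 g T) = (a @ x # b) # ?U"
      using bump.hyps by (subst insert_from_bump) auto
    then have U2: "insert_from k x (add_at r g ((a @ y # b) # T)) = (a @ x # b) # ?U"
      using Suc by simp
    have "(\<exists>r'\<le>length ?T. ?U = add_at r' g ?T \<and> clear g r' ?T) \<or>
      (\<exists>r'\<le>length ?U. g = Bar (r' + Suc k) \<and> g \<notin> letters ?U \<and>
        ?T = add_at r' (Plain (r' + Suc k)) ?U \<and> full (Plain (r' + Suc k)) (drop r' ?U) \<and>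
        grows r' ?U (add_at r1 g T))"
      using bump.prems Suc Plain_Suc_le_bumped[OF bump.prems(4) bump.hyps(2,3)] g
        order_le_neq_trans[OF g(3,2)]
      by (intro bump.IH) auto
    then show ?thesis
    proof (elim disjE exE conjE)
      fix r' assume "r' \<le> length ?T" "?U = add_at r' g ?T" "clear g r' ?T"
      then show ?thesis
        unfolding U2 T2 using g(1) by (intro disjI1 exI[of _ "Suc r'"]) auto
    next
      fix r' assume "r' \<le> length ?U" "g = Bar (r' + Suc k)" "g \<notin> letters ?U"
        "?T = add_at r' (Plain (r' + Suc k)) ?U" "full (Plain (r' + Suc k)) (drop r' ?U)"
        "grows r' ?U (add_at r1 g T)"
      then show ?thesis
        unfolding U2 T2 using g(1) Suc by (intro disjI2 exI[of _ "Suc r'"]) auto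
    qed
  qed
qed

section \<open>Shapes and local rules\<close>

definition cells :: "letter list list \<Rightarrow> shape" where
  "cells T = {(i, j). 1 \<le> i \<and> 1 \<le> j \<and> j \<le> rowlen T (i - 1)}"

lemma dom_filling: "dom (filling T) = cells T"
  by (auto simp: cells_def filling_def rowlen_def dom_def split: if_splits)

lemma filling_simps [simp]:
  "filling T (0, j) = None" "filling T (i, 0) = None"
  "filling T (Suc i, Suc j) = (if i < length T \<and> j < length (T ! i) then Some (T ! i ! j) else None)"
  by (auto simp: filling_def)

lemma filling_eq_Some:
  "filling T (i, j) = Some x \<longleftrightarrow> (\<exists>i' j'. i = Suc i' \<and> j = Suc j' \<and> i' < length T \<and> j' < length (T ! i') \<and> T ! i' ! j' = x)"
  by (cases i; cases j) auto

lemma ran_filling: "ran (filling T) = letters T"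
proof -
  have "\<exists>p. filling T p = Some x" if "x \<in> letters T" for x
  proof -
    obtain i j where "i < length T" "j < length (T ! i)" "x = T ! i ! j"
      using \<open>x \<in> letters T\<close> by (auto simp: in_set_conv_nth)
    then show ?thesis by (intro exI[of _ "(Suc i, Suc j)"]) simp
  qed
  moreover have "x \<in> letters T" if "filling T p = Some x" for x p
    using that nth_mem by (cases p) (fastforce simp: filling_eq_Some)
  ultimately show ?thesis by (auto simp: ran_def)
qed

lemma rowlen_Suc_le:
  "sp_tableau k T \<Longrightarrow> rowlen T (Suc i) \<le> rowlen T i"
proof (induction T arbitrary: k i)
  case (Cons R T)
  then show ?case by (cases i) (auto simp: above_def length_top_row)
qed simp

lemma rowlen_antimono: "sp_tableau k T \<Longrightarrow> i \<le> j \<Longrightarrow> rowlen T j \<le> rowlen T i"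
  by (rule lift_Suc_antimono_le[of "rowlen T"]) (rule rowlen_Suc_le)

lemma sp_tableau_nth:
  "sp_tableau k T \<Longrightarrow> i < length T \<Longrightarrow> T ! i \<noteq> [] \<and> sorted (T ! i) \<and> (\<forall>x\<in>set (T ! i). Plain (k + i) \<le> x)"
proof (induction T arbitrary: k i)
  case (Cons R T)
  then show ?case using Cons.IH[of "Suc k" "i - 1"] by (cases i) auto
qed simp

lemma sp_tableau_above:
  "sp_tableau k T \<Longrightarrow> Suc i < length T \<Longrightarrow> above (T ! i) (T ! Suc i)"
proof (induction T arbitrary: k i)
  case (Cons R T)
  then show ?case by (cases i; cases T) auto
qed simp

lemma sp_tableau_column_less:
  assumes "sp_tableau k T" "i < j" "j < length T" "c < length (T ! j)"
  shows "T ! i ! c < T ! j ! c"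
  using assms(2-4)
proof (induction j)
  case (Suc j)
  have ab: "above (T ! j) (T ! Suc j)"
    using assms(1) Suc.prems(2) by (rule sp_tableau_above)
  then have "T ! j ! c < T ! Suc j ! c" "c < length (T ! j)"
    using Suc.prems(3) by (auto simp: above_def)
  then show ?case
    using Suc by (cases "i = j") auto
qed simp

text \<open>The first letter of the last row is at least the \<open>Plain\<close> letter of that
  row's number, so a bound on indices is a bound on rows.\<close>

lemma length_sp_tableau_le:
  assumes "sp_tableau k T" "\<And>z. z \<in> letters T \<Longrightarrow> index z \<le> m" "k \<le> Suc m"
  shows "length T + k \<le> Suc m"
proof (cases "length T")
  case (Suc i)
  then have i: "i < length T" by simp
  then have "hd (T ! i) \<in> set (T ! i)" "Plain (k + i) \<le> hd (T ! i)"
    using sp_tableau_nth[OF assms(1) i] by auto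
  moreover from this have "hd (T ! i) \<in> letters T"
    using nth_mem[OF i] by auto
  ultimately show ?thesis
    using assms(2)[of "hd (T ! i)"] Suc by (simp add: Plain_le_iff)
qed (use assms(3) in simp)

lemma is_diagram_cells:
  assumes "sp_tableau k T"
  shows "is_diagram (cells T)"
proof -
  have "cells T \<subseteq> (\<Union>i<length T. {Suc i} \<times> {1..rowlen T i})"
  proof
    fix p assume p: "p \<in> cells T"
    then obtain i j where "p = (Suc i, j)" "1 \<le> j" "j \<le> rowlen T i"
      by (cases p; cases "fst p") (auto simp: cells_def)
    then show "p \<in> (\<Union>i<length T. {Suc i} \<times> {1..rowlen T i})"
      by (auto simp: rowlen_def split: if_splits)
  qed
  then have "finite (cells T)"
    by (rule finite_subset) auto
  moreover have "{1..i} \<times> {1..j} \<subseteq> cells T" if "(i, j) \<in> cells T" for i j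
  proof clarify
    fix i' j' assume "i' \<in> {1..i}" "j' \<in> {1..j}"
    moreover from this have "rowlen T (i - 1) \<le> rowlen T (i' - 1)"
      by (intro rowlen_antimono[OF assms]) auto
    ultimately show "(i', j') \<in> cells T"
      using that by (auto simp: cells_def)
  qed
  ultimately show ?thesis
    by (auto simp: is_diagram_def cells_def)
qed

lemma nrows_cells:
  assumes "sp_tableau k T"
  shows "nrows (cells T) = length T"
proof -
  have "fst ` cells T = {1..length T}"
  proof (intro equalityI subsetI)
    fix i assume "i \<in> fst ` cells T"
    then show "i \<in> {1..length T}"
      by (auto simp: cells_def rowlen_def split: if_splits)
  next
    fix i assume i: "i \<in> {1..length T}"
    then have "i - 1 < length T"
      by auto
    then have "T ! (i - 1) \<noteq> []"
      using sp_tableau_nth[OF assms] by blast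
    then have "(i, 1) \<in> cells T"
      using i by (auto simp: cells_def rowlen_def Suc_le_eq)
    then show "i \<in> fst ` cells T" by force
  qed
  then show ?thesis by (simp add: nrows_def)
qed

lemma cells_cong: "rowlen T = rowlen T' \<Longrightarrow> cells T = cells T'"
  by (simp add: cells_def)

lemma cells_grows:
  assumes "grows s T T'"
  shows "cells T' = insert (Suc s, Suc (rowlen T s)) (cells T)" "(Suc s, Suc (rowlen T s)) \<notin> cells T"
  using assms by (auto simp: grows_def cells_def split: if_splits)

lemma plus_box_grows:
  assumes "grows s T T'" "sp_tableau k T" "sp_tableau k' T'"
  shows "plus_box (Suc s) (cells T) (cells T')"
  using cells_grows[OF assms(1)] is_diagram_cells assms(2,3) unfolding plus_box_def by blast

section \<open>Covers, and the local rules read backwards\<close>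

lemma plus_box_card: "plus_box k A B \<Longrightarrow> card B = Suc (card A)"
  by (auto simp: plus_box_def is_diagram_def)

lemma covers_card: "covers B A \<Longrightarrow> card B = Suc (card A)"
  by (auto simp: covers_def plus_box_card)

lemma covers_finite: "covers B A \<Longrightarrow> finite A \<and> finite B"
  unfolding covers_def plus_box_def is_diagram_def by blast

lemma covers_subset: "covers B A \<Longrightarrow> A \<subseteq> B"
  by (auto simp: covers_def plus_box_def)

lemma plus_box_unique_row: "plus_box k A B \<Longrightarrow> plus_box k' A B \<Longrightarrow> k = k'"
  by (auto simp: plus_box_def)

lemma plus_box_unique:
  assumes "plus_box k A B" "plus_box k A B'"
  shows "B = B'"
proof -
  obtain c c' where c: "(k, c) \<notin> A" "B = insert (k, c) A" "(k, c') \<notin> A" "B' = insert (k, c') A"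
    and d: "is_diagram B" "is_diagram B'"
    using assms by (auto simp: plus_box_def)
  have "\<not> c < c'" if "is_diagram (insert (k, c') A)" "is_diagram (insert (k, c) A)" "(k, c) \<notin> A" for c c'
  proof
    assume "c < c'"
    have "1 \<le> k" "1 \<le> c" "{1..k} \<times> {1..c'} \<subseteq> insert (k, c') A"
      using that by (auto simp: is_diagram_def)
    moreover from this have "(k, c) \<in> {1..k} \<times> {1..c'}"
      using \<open>c < c'\<close> by auto
    ultimately have "(k, c) \<in> insert (k, c') A" by blast
    then show False using \<open>c < c'\<close> that by auto
  qed
  from this[of c' c] this[of c c'] c d have "c = c'"
    by (metis linorder_neqE_nat)
  then show ?thesis using c by simp
qed

text \<open>Both A and D have one cell more than C, and comparing sizes leaves only
  \<open>jdt\<close>. For fixed B and C its formula is an involution exchanging A and D.\<close>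

lemma local_rule_backwards_grow:
  assumes "local_rule x \<rho> A B C D" "covers A C" "covers D C"
  shows "A = (if domino (B - C) then D else C \<union> (B - D))"
proof -
  have card: "card C < card A" "card C < card D"
    using assms(2,3) by (auto simp: covers_card)
  have fin: "finite C"
    using covers_finite[OF assms(2)] by simp
  show ?thesis
    using assms(1)
  proof cases
    case carry_vertical
    then show ?thesis using card by simp
  next
    case carry_horizontal
    then show ?thesis using card by simp
  next
    case cross
    then show ?thesis using card by simp
  next
    case (rule_M k k')
    then show ?thesis using card plus_box_card[OF rule_M(4)] by simp
  next
    case (rule_R k)
    then show ?thesis using card plus_box_card[of k A B] by simp
  next
    case (rule_circ k)
    then show ?thesis using card plus_box_card[of k A B] by simp
  next
    case jdt
    then have sub: "C \<subseteq> A" "A \<subseteq> B"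
      by (simp_all add: covers_subset)
    show ?thesis
    proof (cases "domino (B - C)")
      case True
      then show ?thesis using jdt(2) by simp
    next
      case False
      then have "D = C \<union> (B - A)" using jdt(2) by simp
      then have "A = C \<union> (B - D)" using sub by blast
      then show ?thesis using False by simp
    qed
  next
    case jdt_sym
    then show ?thesis using card covers_card[of C A] by simp
  next
    case (rule_W k k')
    have "card (B \<inter> C) \<le> card C"
      using fin by (intro card_mono) auto
    then show ?thesis using card rule_W by simp
  next
    case (rule_Ya k)
    then show ?thesis using card plus_box_card[of "k - 1" D B] by simp
  qed
qed

text \<open>Comparing sizes leaves \<open>RuleW\<close> and \<open>RuleYa\<close>, and whether B
  equals C decides between them. In the second case k is the row of the box of C outside D, so A is
  determined as well.\<close>

lemma local_rule_backwards_shrink: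
  assumes "local_rule x \<rho> A B C D" "covers A C" "covers C D"
  shows "B \<noteq> C \<and> A = B \<union> C \<or> B = C \<and> (\<exists>k. plus_box (Suc k) C A \<and> plus_box k D C \<and> Plain (Suc k) \<le> x)"
proof -
  have card: "card C < card A" "card D < card C"
    using assms(2,3) by (auto simp: covers_card)
  show ?thesis
    using assms(1)
  proof cases
    case carry_vertical
    then show ?thesis using card by simp
  next
    case carry_horizontal
    then show ?thesis using card by simp
  next
    case cross
    then show ?thesis using card by simp
  next
    case (rule_M k k')
    then show ?thesis using card plus_box_card[OF rule_M(4)] by simp
  next
    case (rule_R k)
    then show ?thesis using card plus_box_card[of k A B] by simp
  next
    case (rule_circ k)
    then show ?thesis using card plus_box_card[of k A B] by simp
  next
    case jdt
    have "finite D"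
      using covers_finite[OF assms(3)] by simp
    then have "C \<subseteq> D \<Longrightarrow> card C \<le> card D"
      by (rule card_mono)
    moreover have "D = A \<or> C \<subseteq> D"
      using jdt(2) by (auto split: if_splits)
    ultimately show ?thesis using card by auto
  next
    case jdt_sym
    then show ?thesis using card covers_card[of C A] by simp
  next
    case (rule_W k k')
    then obtain c c' where "A = insert (k, c) B" "(k, c) \<notin> B" "A = insert (k', c') C" "(k', c') \<notin> C"
      by (auto simp: plus_box_def)
    then show ?thesis using \<open>k \<noteq> k'\<close> by auto
  next
    case (rule_Ya k)
    then show ?thesis by (intro disjI2 conjI exI[of _ "k - 1"]) auto
  qed
qed

lemma local_rule_circD:
  assumes "local_rule x Circ A B C D"
  shows "B = C \<and> D = A \<and> (\<exists>k. plus_box k A B \<and> x \<le> Bar k)"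
  using assms
proof cases
  case (rule_circ k)
  then show ?thesis by blast
qed

lemma not_circ_grow:
  assumes "covers D C"
  shows "\<not> local_rule x Circ A B C D"
proof
  assume "local_rule x Circ A B C D"
  then obtain k where "B = C" "D = A" "plus_box k A B"
    using local_rule_circD by blast
  then have "card A = Suc (card B)"
    using covers_card[OF assms] by simp
  then show False
    using plus_box_card[OF \<open>plus_box k A B\<close>] by linarith
qed

section \<open>Extension by a letter in the first column without it\<close>

lemma local_step_backwards_grow:
  assumes T: "sp_tableau 1 T" "sp_tableau 1 T'" and U: "sp_tableau 1 U" "grows r T U"
    and U': "sp_tableau 1 U'" "grows r' T' U'" and s: "grows s T T'"
    and step: "r' = r \<or> s = r \<and> r' = Suc r \<and> rowlen T (Suc r) = rowlen T r"
  shows "cells U = (if domino (cells U' - cells T) then cells T' else cells T \<union> (cells U' - cells T'))"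
proof -
  note C = cells_grows[OF s] cells_grows[OF U(2)] cells_grows[OF U'(2)]
  have T's: "rowlen T' s = Suc (rowlen T s)" "\<And>i. i \<noteq> s \<Longrightarrow> rowlen T' i = rowlen T i"
    using s by (auto simp: grows_def)
  show ?thesis
  proof (cases "s = r")
    case True
    then have "rowlen U = rowlen T'"
      using U(2) s by (simp add: grows_def)
    then have eq: "cells U = cells T'"
      by (rule cells_cong)
    have "cells U' - cells T = {(Suc r, Suc (rowlen T r)), (Suc r', Suc (rowlen T' r'))}"
      using C(1,2,5,6) True by auto
    moreover have "domino {(Suc r, Suc (rowlen T r)), (Suc r', Suc (rowlen T' r'))}"
    proof (cases "r' = r")
      case r': True
      have "rowlen T' r' = Suc (rowlen T r)"
        using T's(1) True r' by simp
      then show ?thesis unfolding domino_def r' by metis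
    next
      case False
      then have r': "r' = Suc r" "rowlen T (Suc r) = rowlen T r"
        using step by simp_all
      then have "rowlen T' r' = rowlen T r"
        using T's(2)[of r'] True by simp
      then show ?thesis unfolding domino_def r'(1) by metis
    qed
    ultimately have "domino (cells U' - cells T)"
      by simp
    then show ?thesis using eq by simp
  next
    case False
    then have r': "r' = r" "rowlen T' r = rowlen T r"
      using step T's by auto
    then have diff: "cells U' - cells T = {(Suc r, Suc (rowlen T r)), (Suc s, Suc (rowlen T s))}"
      using C(1,2,5,6) by auto
    \<comment> \<open>A domino would put the two boxes into adjacent rows of one column. The tableau
      containing only the lower one, T' or U, would then have a row longer than the row above
      it.\<close>
    have "\<not> domino (cells U' - cells T)"
    proof
      assume "domino (cells U' - cells T)"
      then have "rowlen T r = rowlen T s \<and> (s = Suc r \<or> r = Suc s)"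
        unfolding domino_def diff using False by (auto simp: doubleton_eq_iff)
      moreover have "rowlen T' (Suc r) \<le> rowlen T' r"
        using T(2) by (rule rowlen_Suc_le)
      moreover have "rowlen U (Suc s) \<le> rowlen U s"
        using U(1) by (rule rowlen_Suc_le)
      ultimately show False
        using T's r' False U(2) by (auto simp: grows_def)
    qed
    moreover have "cells U' - cells T' = {(Suc r, Suc (rowlen T r))}"
      using C(5,6) r' by auto
    ultimately show ?thesis using C(3) by simp
  qed
qed

lemma local_step_unique:
  assumes T: "sp_tableau 1 T" "sp_tableau 1 T'" and U: "sp_tableau 1 U" "grows r T U"
    and U': "sp_tableau 1 U'" "grows r' T' U'" and step: "local_step r r' T T'"
    and A: "covers A (cells T)" "local_rule x \<rho> A (cells U') (cells T) (cells T')"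
  shows "A = cells U"
  using step unfolding local_step_def
proof (elim disjE exE conjE)
  fix s assume s: "grows s T T'" and "r' = r"
  then have "covers (cells T') (cells T)"
    using plus_box_grows[OF s T] by (auto simp: covers_def)
  from local_rule_backwards_grow[OF A(2,1) this] local_step_backwards_grow[OF T U U' s] \<open>r' = r\<close>
  show ?thesis by simp
next
  fix s assume s: "grows s T T'" and *: "s = r" "r' = Suc r" "rowlen T (Suc r) = rowlen T r"
  then have "covers (cells T') (cells T)"
    using plus_box_grows[OF s T] by (auto simp: covers_def)
  from local_rule_backwards_grow[OF A(2,1) this] local_step_backwards_grow[OF T U U' s] *
  show ?thesis by simp
next
  fix s assume s: "grows s T' T" and r: "r' = r" "s \<noteq> r"
  then have cov: "covers (cells T) (cells T')"
    using plus_box_grows[OF s T(2,1)] by (auto simp: covers_def)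
  have r_len: "rowlen T r = rowlen T' r"
    using s r by (simp add: grows_def)
  have C: "cells T = insert (Suc s, Suc (rowlen T' s)) (cells T')"
    "cells U = insert (Suc r, Suc (rowlen T' r)) (cells T)"
    "cells U' = insert (Suc r, Suc (rowlen T' r)) (cells T')"
    "(Suc s, Suc (rowlen T' s)) \<notin> cells T'" "(Suc r, Suc (rowlen T' r)) \<notin> cells T'"
    using cells_grows[OF s] cells_grows[OF U(2)] cells_grows[OF U'(2)] r r_len by auto
  have "(Suc r, Suc (rowlen T' r)) \<in> cells U'"
    unfolding C(3) by simp
  moreover have "(Suc r, Suc (rowlen T' r)) \<notin> cells T"
    unfolding C(1) using C(5) r by simp
  ultimately have "cells U' \<noteq> cells T" by blast
  moreover have "cells U = cells U' \<union> cells T"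
    unfolding C(1,2,3) by auto
  ultimately show ?thesis
    using local_rule_backwards_shrink[OF A(2,1) cov] by auto
next
  fix s assume s: "grows s T' T" and r: "r' = s" "r = Suc s"
  \<comment> \<open>This alternative is \<open>RuleYa\<close>: in U' the additional box takes the
    place of the box that T loses, so the two shapes coincide.\<close>
  have pb: "plus_box (Suc s) (cells T') (cells T)"
    using plus_box_grows[OF s T(2,1)] .
  have "rowlen U' = rowlen T"
    using s U'(2) r by (simp add: grows_def)
  then have "cells U' = cells T"
    by (rule cells_cong)
  then obtain k where k: "plus_box (Suc k) (cells T) A" "plus_box k (cells T') (cells T)"
    using local_rule_backwards_shrink[OF A(2,1)] pb unfolding covers_def by blast
  then have "k = Suc s"
    using pb plus_box_unique_row by blast
  then show ?thesis
    using k(1) plus_box_grows[OF U(2) T(1) U(1)] r plus_box_unique by blast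
qed

text \<open>A circle would need T to lose a box in a row k with m at most k, and U' to regain it. In
  the \<open>RuleW\<close> alternative the lost and the additional box lie in different rows; in the
  \<open>RuleYa\<close> alternative U has a box in row k + 1, beyond its bound m.\<close>

lemma local_step_not_circ:
  assumes T: "sp_tableau 1 T" "sp_tableau 1 T'"
    and U: "length U \<le> m" "grows r T U"
    and U': "sp_tableau 1 U'" "grows r' T' U'" and step: "local_step r r' T T'"
  shows "\<not> local_rule (Bar m) Circ A (cells U') (cells T) (cells T')"
proof
  assume "local_rule (Bar m) Circ A (cells U') (cells T) (cells T')"
  then obtain k where k: "cells U' = cells T" "plus_box k (cells T') (cells T)" "Bar m \<le> Bar k"
    using local_rule_circD by metis
  have "plus_box (Suc r') (cells T') (cells T)"
    using plus_box_grows[OF U'(2) T(2) U'(1)] k(1) by simp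
  then have k': "k = Suc r'"
    using k(2) plus_box_unique_row by blast
  have no: "\<not> grows s T T'" for s
    using not_circ_grow plus_box_grows[OF _ T] \<open>local_rule (Bar m) Circ A _ _ _\<close>
    unfolding covers_def by blast
  show False
    using step unfolding local_step_def
  proof (elim disjE exE conjE)
    fix s assume s: "grows s T' T" and "r' = r" "s \<noteq> r"
    then have "Suc s = Suc r"
      using plus_box_grows[OF s T(2,1)] k(2) k' plus_box_unique_row by blast
    then show False using \<open>s \<noteq> r\<close> by simp
  next
    fix s assume "grows s T' T" and r: "r' = s" "r = Suc s"
    have "rowlen U r = Suc (rowlen T r)"
      using U(2) by (simp add: grows_def)
    then have "r < length U"
      by (simp add: rowlen_def split: if_splits)
    then show False using U(1) k(3) k' r by (simp add: le_Bar_iff)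
  qed (use no in blast)+
qed

text \<open>This expresses by rows that U is T with a \<open>Plain m\<close> at the bottom of the
  first column without it, as \<open>extension_add_to_first_column\<close> shows. In this form it
  can be followed through an insertion row by row.\<close>

definition extension :: "nat \<Rightarrow> letter list list \<Rightarrow> letter list list \<Rightarrow> bool" where
  "extension m T U \<longleftrightarrow> sp_tableau 1 T \<and> sp_tableau 1 U \<and> (\<forall>z\<in>letters T. z \<le> Plain m) \<and>
     (\<exists>r\<le>length T. U = add_at r (Plain m) T \<and> full (Plain m) (drop r T))"

lemma letters_add_at: "r \<le> length T \<Longrightarrow> letters (add_at r g T) = insert g (letters T)"
  by (induction r g T rule: add_at.induct) auto

lemma extension_step:
  assumes ext: "extension m T U" and x: "Plain 1 \<le> x" "x \<le> Plain m"
  shows "extension m (insert_from 1 x T) (insert_from 1 x U)"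
    and "covers A (cells T) \<Longrightarrow>
      local_rule (Bar m) \<rho> A (cells (insert_from 1 x U)) (cells T) (cells (insert_from 1 x T)) \<Longrightarrow> A = cells U"
    and "\<not> local_rule (Bar m) Circ A (cells (insert_from 1 x U)) (cells T) (cells (insert_from 1 x T))"
proof -
  let ?T = "insert_from 1 x T" and ?U = "insert_from 1 x U"
  from ext obtain r where T: "sp_tableau 1 T" and U: "sp_tableau 1 U" and le: "\<And>z. z \<in> letters T \<Longrightarrow> z \<le> Plain m"
    and r: "r \<le> length T" "U = add_at r (Plain m) T" "full (Plain m) (drop r T)"
    unfolding extension_def by blast
  have "\<exists>r'\<le>length ?T. insert_from 1 x (add_at r (Plain m) T) = add_at r' (Plain m) ?T \<and>
      full (Plain m) (drop r' ?T) \<and> local_step r r' T ?T"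
    using T U r x le by (intro insert_from_add_at_full) auto
  then obtain r' where r': "r' \<le> length ?T" "?U = add_at r' (Plain m) ?T" "full (Plain m) (drop r' ?T)"
    "local_step r r' T ?T"
    using r(2) by blast
  have T': "sp_tableau 1 ?T" and U': "sp_tableau 1 ?U"
    using insert_from_sp_tableau(1) T U x(1) by blast+
  have "\<forall>z\<in>letters ?T. z \<le> Plain m"
    using letters_insert_from[of 1 x T] le x(2) by blast
  then show "extension m ?T ?U"
    unfolding extension_def using T' U' r' by blast
  have gU: "grows r T U" and gU': "grows r' ?T ?U"
    using grows_add_at r r' by auto
  show "A = cells U" if "covers A (cells T)" "local_rule (Bar m) \<rho> A (cells ?U) (cells T) (cells ?T)"
    using local_step_unique[OF T T' U gU U' gU' r'(4) that] .
  have "index z \<le> m" if "z \<in> letters U" for z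
  proof -
    have "z \<in> insert (Plain m) (letters T)"
      using that r(1,2) letters_add_at by blast
    then have "z < Bar m"
      using le unfolding less_Bar_iff by blast
    then show ?thesis
      using le_Bar_iff less_imp_le by blast
  qed
  then have "length U \<le> m"
    using length_sp_tableau_le[OF U] by fastforce
  then show "\<not> local_rule (Bar m) Circ A (cells ?U) (cells T) (cells ?T)"
    using local_step_not_circ[OF T T' _ gU U' gU' r'(4)] by blast
qed

text \<open>Follow the column downwards: if its entry in some row is not g, neither are the entries
  to the left, so by fullness the next row reaches this column too. As there are finitely many rows,
  g must be met.\<close>

lemma full_column:
  assumes "full g T" "sp_tableau k T" "\<And>z. z \<in> letters T \<Longrightarrow> z \<le> g" "c < length (top_row T)"
  shows "\<exists>i<length T. c < length (T ! i) \<and> T ! i ! c = g"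
  using assms
proof (induction T arbitrary: k)
  case (Cons R T)
  show ?case
  proof (cases "R ! c = g")
    case True
    then show ?thesis using Cons.prems(4) by (intro exI[of _ 0]) simp
  next
    case False
    have c: "c < length R" using Cons.prems(4) by simp
    then have "R ! c \<le> g"
      using Cons.prems(3) by (auto simp del: nth_mem simp: nth_mem[OF c])
    then have lt: "R ! c < g"
      using False by simp
    have "sorted (take c R @ R ! c # drop (Suc c) R)"
      using Cons.prems(2) id_take_nth_drop[OF c] by simp
    then have "filter (\<lambda>x. x \<noteq> g) (take c R) = take c R"
      using lt by (rule filter_less_max)
    then have "filter (\<lambda>x. x \<noteq> g) R = take c R @ R ! c # filter (\<lambda>x. x \<noteq> g) (drop (Suc c) R)"
      using False by (subst (1) id_take_nth_drop[OF c]) simp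
    then have "c < length (filter (\<lambda>x. x \<noteq> g) R)"
      using c by simp
    then have "c < length (top_row T)"
      using Cons.prems(1) by simp
    then obtain i where "i < length T" "c < length (T ! i)" "T ! i ! c = g"
      using Cons.IH[of "Suc k"] Cons.prems by auto
    then show ?thesis by (intro exI[of _ "Suc i"]) simp
  qed
qed simp

lemma sp_tableau_drop: "sp_tableau k T \<Longrightarrow> sp_tableau (k + r) (drop r T)"
proof (induction T arbitrary: k r)
  case (Cons R T)
  then show ?case using Cons.IH[of "Suc k" "r - 1"] by (cases r) auto
qed simp

lemma add_at_conv: "r \<le> length T \<Longrightarrow> add_at r g T = (if r < length T then T[r := T ! r @ [g]] else T @ [[g]])"
  by (induction r g T rule: add_at.induct) auto

lemma filling_add_at:
  assumes "r \<le> length T"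
  shows "filling (add_at r g T) = (filling T)((Suc r, Suc (rowlen T r)) \<mapsto> g)"
proof
  fix p :: "nat \<times> nat"
  consider i where "p = (0, i)" | i where "p = (i, 0)" | i j where "p = (Suc i, Suc j)"
    by (cases p) (metis nat.exhaust)
  then show "filling (add_at r g T) p = ((filling T)((Suc r, Suc (rowlen T r)) \<mapsto> g)) p"
  proof cases
    case (3 i j)
    then show ?thesis
      using assms by (auto simp: add_at_conv rowlen_def nth_list_update nth_append less_Suc_eq)
  qed simp_all
qed

lemma extension_grows:
  assumes "extension m T U"
  obtains r where "grows r T U"
  using assms grows_add_at unfolding extension_def by blast

lemma extension_add_to_first_column:
  assumes "extension m T U"
  shows "add_to_first_column (Plain m) (filling T) = filling U"
proof -
  let ?g = "Plain m"
  from assms obtain r where T: "sp_tableau 1 T" and U: "sp_tableau 1 U" and le: "\<And>z. z \<in> letters T \<Longrightarrow> z \<le> ?g"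
    and r: "r \<le> length T" "U = add_at r ?g T" "full ?g (drop r T)"
    unfolding extension_def by blast
  define c where "c = Suc (rowlen T r)"
  have fill: "filling U = (filling T)((Suc r, c) \<mapsto> ?g)"
    using filling_add_at[OF r(1)] r(2) by (simp add: c_def)
  have rU: "rowlen U = (rowlen T)(r := c)"
    using grows_add_at[OF r(1), of ?g] r(2) by (simp add: grows_def c_def)
  \<comment> \<open>Row r and the rows below do not reach column c, so a g in this column would
    stand above row r. But U has its additional g further down in the same column, against
    strictness.\<close>
  have no: "filling T (i, c) \<noteq> Some ?g" for i
  proof
    assume a: "filling T (i, c) = Some ?g"
    then obtain i' where i': "i = Suc i'" "i' < length T" "rowlen T r < length (T ! i')"
      unfolding filling_eq_Some c_def by blast
    then have "rowlen T r < rowlen T i'"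
      by (simp add: rowlen_def)
    then have "i' < r"
      using rowlen_antimono[OF T, of r i'] by (cases "i' < r") auto
    then have "filling U (Suc i', c) = Some ?g"
      using a i' by (simp add: fill del: filling_simps)
    moreover have "filling U (Suc r, c) = Some ?g"
      by (simp add: fill del: filling_simps)
    ultimately show False
      using sp_tableau_column_less[OF U \<open>i' < r\<close>, of "rowlen T r"] by (auto simp: c_def split: if_splits)
  qed
  have "first_column_without ?g (filling T) = c"
    unfolding first_column_without_def
  proof (rule Least_equality)
    show "1 \<le> c \<and> (\<forall>i. filling T (i, c) \<noteq> Some ?g)"
      using no by (simp add: c_def)
    fix c' assume c': "1 \<le> c' \<and> (\<forall>i. filling T (i, c') \<noteq> Some ?g)"
    show "c \<le> c'"
    proof (rule ccontr)
      assume "\<not> c \<le> c'"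
      then obtain d where d: "c' = Suc d" "d < rowlen T r"
        using c' by (cases c') (auto simp: c_def)
      have "length (top_row (drop r T)) = rowlen T r"
        by (simp add: length_top_row rowlen_def)
      then have "d < length (top_row (drop r T))"
        using d(2) by simp
      moreover have "z \<le> ?g" if "z \<in> letters (drop r T)" for z
        using le that by (auto dest: in_set_dropD)
      ultimately obtain i where "i < length (drop r T)" "d < length (drop r T ! i)" "drop r T ! i ! d = ?g"
        using full_column[OF r(3) sp_tableau_drop[OF T]] by blast
      then have "r + i < length T" "d < length (T ! (r + i))" "T ! (r + i) ! d = ?g"
        by simp_all
      then have "filling T (Suc (r + i), c') = Some ?g"
        using d(1) by simp
      then show False using c' by blast
    qed
  qed
  moreover have "column_height (filling T) c = r"
  proof -
    have column: "(i, c) \<in> cells T \<longleftrightarrow> i \<in> {1..r}" for i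
    proof (cases i)
      case (Suc i')
      have "c \<le> rowlen T i'" if "i' < r"
        using rowlen_antimono[OF U, of i' r] that by (simp add: rU)
      moreover have "i' < r" if "c \<le> rowlen T i'"
        using rowlen_antimono[OF T, of r i'] that by (cases "i' < r") (auto simp: c_def)
      ultimately show ?thesis
        using Suc by (auto simp: cells_def c_def)
    qed (simp add: cells_def)
    have "{i. (i, c) \<in> dom (filling T)} = {1..r}"
      unfolding dom_filling column by (rule Collect_mem_eq)
    then show ?thesis
      by (simp add: column_height_def)
  qed
  ultimately show ?thesis
    by (simp add: add_to_first_column_def fill Let_def)
qed

lemma deletes_rightmost_add_at:
  assumes "sp_tableau k T" "r \<le> length T" "clear g r T"
  shows "deletes_rightmost g (filling (add_at r g T)) (filling T)"
proof -
  let ?p = "(Suc r, Suc (rowlen T r))"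
  have fill: "filling (add_at r g T) = (filling T)(?p \<mapsto> g)"
    using assms(2) by (rule filling_add_at)
  have None: "filling T ?p = None"
    by (simp add: rowlen_def)
  have "j < Suc (rowlen T r)" if "filling T (i, j) = Some g" for i j
  proof -
    from that obtain i' j' where ij: "i = Suc i'" "j = Suc j'" "i' < length T" "j' < length (T ! i')" "T ! i' ! j' = g"
      unfolding filling_eq_Some by blast
    have "r \<le> i'"
    proof (rule ccontr)
      assume "\<not> r \<le> i'"
      then have "T ! i' \<in> set (take r T)"
        using ij(3) by (auto simp: in_set_conv_nth)
      moreover have "g \<in> set (T ! i')"
        using ij(4,5) nth_mem by blast
      ultimately show False using assms(3) by (auto simp: clear_def)
    qed
    then have "rowlen T i' \<le> rowlen T r"
      by (rule rowlen_antimono[OF assms(1)])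
    then show ?thesis using ij by (simp add: rowlen_def)
  qed
  then have "\<forall>i j. filling (add_at r g T) (i, j) = Some g \<and> (i, j) \<noteq> ?p \<longrightarrow> j < Suc (rowlen T r)"
    by (simp add: fill del: filling_simps)
  moreover have "filling T = (filling (add_at r g T))(?p := None)"
    using None by (simp add: fill fun_upd_idem del: filling_simps)
  moreover have "filling (add_at r g T) ?p = Some g"
    by (simp add: fill del: filling_simps)
  ultimately show ?thesis
    unfolding deletes_rightmost_def by blast
qed

section \<open>Insertion of words\<close>

abbreviation insert_word :: "letter list \<Rightarrow> letter list list \<Rightarrow> letter list list" where
  "insert_word w T \<equiv> fold (insert_from 1) w T"

lemma insert_word_sp_tableau:
  "sp_tableau 1 T \<Longrightarrow> (\<And>x. x \<in> set w \<Longrightarrow> Plain 1 \<le> x) \<Longrightarrow> sp_tableau 1 (insert_word w T)"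
  by (induction w arbitrary: T) (simp_all add: insert_from_sp_tableau(1))

lemma letters_insert_word: "letters (insert_word w T) \<subseteq> set w \<union> letters T"
proof (induction w arbitrary: T)
  case (Cons x w)
  have "letters (insert_word w (insert_from 1 x T)) \<subseteq> set w \<union> letters (insert_from 1 x T)"
    by (rule Cons)
  then have "letters (insert_word (x # w) T) \<subseteq> set w \<union> letters (insert_from 1 x T)"
    by simp
  then show ?case
    using letters_insert_from[of 1 x T] by auto
qed simp

text \<open>In the second alternative the roles are exchanged: the tableau that contained g is now
  the smaller one in \<open>extension\<close>. The equation between \<open>cells\<close> says that
  the upper right and the lower left shape of the cell of cancellation agree, as in
  \<open>Circ\<close>.\<close>

lemma insert_word_add_at:
  assumes "sp_tableau 1 T" and "sp_tableau 1 (add_at r g T)" and "r \<le> length T" and "clear g r T"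
    and "\<And>z. z \<in> letters T \<Longrightarrow> z \<le> g" and "\<And>x. x \<in> set v \<Longrightarrow> Plain 1 \<le> x \<and> x < g"
  shows "(\<exists>r'\<le>length (insert_word v T).
      insert_word v (add_at r g T) = add_at r' g (insert_word v T) \<and> clear g r' (insert_word v T)) \<or>
    (\<exists>v1 x v2 m. v = v1 @ x # v2 \<and> g = Bar m \<and>
      extension m (insert_word (v1 @ [x]) (add_at r g T)) (insert_word (v1 @ [x]) T) \<and>
      cells (insert_word (v1 @ [x]) T) = cells (insert_word v1 (add_at r g T)) \<and>
      plus_box m (cells (insert_word (v1 @ [x]) (add_at r g T))) (cells (insert_word v1 (add_at r g T))))"
  using assms
proof (induction v arbitrary: T r)
  case Nil
  then show ?case by auto
next
  case (Cons x v)
  let ?U = "add_at r g T"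
  let ?T2 = "insert_from 1 x T" and ?U2 = "insert_from 1 x ?U"
  have x: "Plain 1 \<le> x" "x < g"
    using Cons.prems(6) by auto
  have T2: "sp_tableau 1 ?T2" and U2: "sp_tableau 1 ?U2"
    using Cons.prems(1,2) x insert_from_sp_tableau(1) by blast+
  have lT2: "z \<le> g" if "z \<in> letters ?T2" for z
  proof -
    have "z \<in> insert x (letters T)"
      using that letters_insert_from[of 1 x T] by blast
    then show ?thesis using Cons.prems(5) x(2) by auto
  qed
  consider r' where "r' \<le> length ?T2" "?U2 = add_at r' g ?T2" "clear g r' ?T2"
    | r' where "r' \<le> length ?U2" "g = Bar (r' + 1)" "g \<notin> letters ?U2" "?T2 = add_at r' (Plain (r' + 1)) ?U2"
        "full (Plain (r' + 1)) (drop r' ?U2)" "grows r' ?U2 ?U"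
    using insert_from_add_at_clear[OF Cons.prems(1,2,3) x Cons.prems(5,4)] by blast
  then show ?case
  proof cases
    case (1 r')
    from Cons.IH[of ?T2 r'] T2 U2 1 lT2 Cons.prems(6)
    consider "\<exists>r''\<le>length (insert_word v ?T2).
        insert_word v ?U2 = add_at r'' g (insert_word v ?T2) \<and> clear g r'' (insert_word v ?T2)"
      | v1 y v2 m where "v = v1 @ y # v2" "g = Bar m"
        "extension m (insert_word (v1 @ [y]) ?U2) (insert_word (v1 @ [y]) ?T2)"
        "cells (insert_word (v1 @ [y]) ?T2) = cells (insert_word v1 ?U2)"
        "plus_box m (cells (insert_word (v1 @ [y]) ?U2)) (cells (insert_word v1 ?U2))"
      by auto
    then show ?thesis
    proof cases
      case 1
      then show ?thesis by (intro disjI1) simp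
    next
      case (2 v1 y v2 m)
      then show ?thesis
        by (intro disjI2 exI[of _ "x # v1"] exI[of _ y] exI[of _ v2] exI[of _ m]) simp
    qed
  next
    case (2 r')
    have "z \<le> Plain (r' + 1)" if z: "z \<in> letters ?U2" for z
    proof -
      have "z \<in> insert x (insert g (letters T))"
        using z letters_insert_from[of 1 x ?U] letters_add_at[OF Cons.prems(3), of g] by blast
      then have "z \<le> g"
        using x(2) Cons.prems(5) by auto
      moreover have "z \<noteq> g" using z 2(3) by blast
      ultimately have "z < Bar (r' + 1)"
        using 2(2) by simp
      then show ?thesis by (simp add: less_Bar_iff)
    qed
    then have "extension (r' + 1) ?U2 ?T2"
      unfolding extension_def using T2 U2 2(1,4,5) by blast
    moreover have "rowlen ?T2 = rowlen ?U"
      using grows_add_at[OF 2(1)] 2(4,6) unfolding grows_def by metis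
    then have "cells ?T2 = cells ?U"
      by (rule cells_cong)
    moreover have "plus_box (r' + 1) (cells ?U2) (cells ?U)"
      using plus_box_grows[OF 2(6) U2 Cons.prems(2)] by simp
    ultimately show ?thesis
      using 2(2) by (intro disjI2 exI[of _ "[]"] exI[of _ x] exI[of _ v] exI[of _ "r' + 1"]) simp
  qed
qed

text \<open>Here \<open>j0\<close> is the vertex from which on the lower tableaux R have extensions
  X: vertex 0 if g is an unbarred letter, the vertex after the cancellation otherwise. The induction
  runs downwards from f, as the test does.\<close>

lemma worked_back_extension:
  assumes chain: "\<And>i. j0 \<le> i \<Longrightarrow> i < f \<Longrightarrow> extension m (R i) (X i) \<and>
      (\<exists>x. Plain 1 \<le> x \<and> x \<le> Plain m \<and> R (Suc i) = insert_from 1 x (R i) \<and> X (Suc i) = insert_from 1 x (X i))"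
    and lower: "\<And>i. i \<le> f \<Longrightarrow> \<kappa> i = cells (R i)"
    and wb: "worked_back (Bar m) f \<kappa> (cells (X f)) j \<mu>"
  shows "j0 \<le> i \<Longrightarrow> j \<le> i \<Longrightarrow> i \<le> f \<Longrightarrow> \<mu> i = cells (X i)"
    and "j0 < j \<Longrightarrow> j \<le> f \<Longrightarrow> \<not> local_rule (Bar m) Circ A (\<mu> j) (\<kappa> (j - 1)) (\<kappa> j)"
proof -
  have eq: "\<mu> i = cells (X i)" if "i \<le> f" "j0 \<le> i" "j \<le> i" for i
    using that
  proof (induction rule: inc_induct)
    case base
    then show ?case using wb by (simp add: worked_back_def)
  next
    case (step i)
    obtain x where x: "extension m (R i) (X i)" "Plain 1 \<le> x" "x \<le> Plain m"
      "R (Suc i) = insert_from 1 x (R i)" "X (Suc i) = insert_from 1 x (X i)"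
      using chain[of i] step by auto
    have "covers (\<mu> i) (\<kappa> i)"
      using wb step unfolding worked_back_def by auto
    moreover obtain \<rho> where "local_rule (Bar m) \<rho> (\<mu> (Suc i - 1)) (\<mu> (Suc i)) (\<kappa> (Suc i - 1)) (\<kappa> (Suc i))"
      using wb step unfolding worked_back_def by (meson greaterThanAtMost_iff Suc_leI le_imp_less_Suc)
    ultimately show ?case
      using extension_step(2)[OF x(1-3), of "\<mu> i" \<rho>] x(4,5) lower[of i] lower[of "Suc i"] step by simp
  qed
  then show "j0 \<le> i \<Longrightarrow> j \<le> i \<Longrightarrow> i \<le> f \<Longrightarrow> \<mu> i = cells (X i)"
    by blast
  show "\<not> local_rule (Bar m) Circ A (\<mu> j) (\<kappa> (j - 1)) (\<kappa> j)" if j: "j0 < j" "j \<le> f"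
  proof -
    obtain i where i: "j = Suc i" "j0 \<le> i" "i < f"
      using j by (cases j) auto
    obtain x where x: "extension m (R i) (X i)" "Plain 1 \<le> x" "x \<le> Plain m"
      "R (Suc i) = insert_from 1 x (R i)" "X (Suc i) = insert_from 1 x (X i)"
      using chain[OF i(2,3)] by auto
    show ?thesis
      using extension_step(3)[OF x(1-3), of A] eq[of j] x(4,5) lower[of i] lower[of j] i j by simp
  qed
qed

section \<open>The standardization and the theorem\<close>

lemma length_std_word [simp]: "length (std_word w) = length w"
  by (simp add: std_word_def)

lemma nth_std_word: "j < length w \<Longrightarrow> std_word w ! j = (w ! j, card {p. p \<le> j \<and> w ! p = w ! j})"
  by (simp add: std_word_def)

lemma card_earlier_copies_less:
  assumes "i < j" "w ! i = w ! j"
  shows "card {p. p \<le> i \<and> w ! p = w ! i} < card {p. p \<le> j \<and> w ! p = w ! j}"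
proof (rule psubset_card_mono)
  show "{p. p \<le> i \<and> w ! p = w ! i} \<subset> {p. p \<le> j \<and> w ! p = w ! j}"
  proof (rule psubsetI)
    have "j \<in> {p. p \<le> j \<and> w ! p = w ! j}" "j \<notin> {p. p \<le> i \<and> w ! p = w ! i}"
      using assms(1) by simp_all
    then show "{p. p \<le> i \<and> w ! p = w ! i} \<noteq> {p. p \<le> j \<and> w ! p = w ! j}"
      by metis
  qed (use assms in auto)
qed simp

lemma distinct_std_word: "distinct (std_word w)"
proof -
  have "std_word w ! i \<noteq> std_word w ! j" if "i < j" "j < length w" for i j
    using card_earlier_copies_less[OF that(1), of w] that by (auto simp: nth_std_word)
  then show ?thesis
    unfolding distinct_conv_nth by (metis length_std_word linorder_neqE_nat)
qed

text \<open>Copies of a letter are ordered by position, so the last copy of the largest letter is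
  the maximum for \<open>std_le\<close>. Its ordinal is the number of all standardized letters,
  which is the length of w because they are distinct.\<close>

lemma std_ord_last_max:
  assumes w: "w = u @ g # v" and g: "g \<notin> set v" "\<And>x. x \<in> set w \<Longrightarrow> x \<le> g" and j: "j < length w"
  shows "std_ord w (std_word w ! j) = length w \<longleftrightarrow> j = length u"
    and "std_ord w (std_word w ! j) \<le> length w"
proof -
  let ?p = "length u" and ?S = "set (std_word w)"
  have card: "card ?S = length w"
    using distinct_card[OF distinct_std_word] by simp
  show le: "std_ord w (std_word w ! j) \<le> length w"
    unfolding std_ord_def card[symmetric] by (intro card_mono) auto
  have p: "?p < length w" "w ! ?p = g"
    by (simp_all add: w)
  have last: "i \<le> ?p" if "i < length w" "w ! i = g" for i
  proof (rule ccontr)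
    assume "\<not> i \<le> ?p"
    then have "w ! i \<in> set v"
      using that(1) by (auto simp: w nth_append nth_Cons split: nat.splits)
    then show False using that(2) g(1) by simp
  qed
  have max: "std_le t (std_word w ! ?p)" if t: "t \<in> ?S" for t
  proof -
    obtain i where i: "i < length w" "t = std_word w ! i"
      using t by (auto simp: in_set_conv_nth)
    show ?thesis
    proof (cases "w ! i = g")
      case True
      have "card {p. p \<le> i \<and> w ! p = w ! i} \<le> card {p. p \<le> ?p \<and> w ! p = w ! ?p}"
        using last[OF i(1) True] True p(2) by (intro card_mono) auto
      then show ?thesis
        using i p True by (simp add: nth_std_word std_le_def)
    next
      case False
      then have "w ! i < g"
        using g(2) i(1) nth_mem by (metis order_le_neq_trans)
      then show ?thesis
        using i p by (simp add: nth_std_word std_le_def)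
    qed
  qed
  show "std_ord w (std_word w ! j) = length w \<longleftrightarrow> j = ?p"
  proof
    assume "j = ?p"
    then have "{t \<in> ?S. std_le t (std_word w ! j)} = ?S"
      using max by auto
    then show "std_ord w (std_word w ! j) = length w"
      by (simp add: std_ord_def card)
  next
    assume ord: "std_ord w (std_word w ! j) = length w"
    have "{t \<in> ?S. std_le t (std_word w ! j)} = ?S"
      using ord by (intro card_subset_eq) (auto simp: std_ord_def card)
    moreover have "std_word w ! ?p \<in> ?S"
      using p(1) by simp
    ultimately have sle: "std_le (std_word w ! ?p) (std_word w ! j)"
      by blast
    show "j = ?p"
    proof (rule ccontr)
      assume "j \<noteq> ?p"
      have "w ! j \<le> g"
        using g(2) j by simp
      then have eq: "w ! j = g"
        using sle j p by (auto simp: nth_std_word std_le_def)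
      then have "j < ?p"
        using last[OF j] \<open>j \<noteq> ?p\<close> by simp
      then have "card {p. p \<le> j \<and> w ! p = w ! j} < card {p. p \<le> ?p \<and> w ! p = w ! ?p}"
        by (rule card_earlier_copies_less) (simp add: eq p(2))
      then show False
        using sle j p eq by (simp add: nth_std_word std_le_def)
    qed
  qed
qed

lemma in_stratum_max:
  assumes "w = u @ g # v" and "g \<notin> set v" "\<And>x. x \<in> set w \<Longrightarrow> x \<le> g"
  shows "in_stratum w g (length w)"
proof -
  have p: "length u < length w" "w ! length u = g"
    by (simp_all add: assms(1))
  then have "fst (std_word w ! length u) = g"
    by (simp add: nth_std_word)
  moreover have "std_word w ! length u \<in> set (std_word w)"
    using p(1) by (intro nth_mem) simp
  moreover have "std_ord w (std_word w ! length u) = length w"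
    using std_ord_last_max(1)[OF assms p(1)] by simp
  ultimately show ?thesis
    unfolding in_stratum_def by blast
qed

lemma P_level_delete_last_max:
  assumes w: "w = u @ g # v" and "g \<notin> set v" "\<And>x. x \<in> set w \<Longrightarrow> x \<le> g"
  shows "P_level w (length w - 1) = berele_P (u @ v)"
proof -
  have "std_ord w (std_word w ! j) \<le> length w - 1 \<longleftrightarrow> j \<noteq> length u" if "j < length w" for j
    using std_ord_last_max[OF assms that] that by auto
  then have "filter (\<lambda>j. std_ord w (std_word w ! j) \<le> length w - 1) [0..<length w] =
      filter (\<lambda>j. j \<noteq> length u) [0..<length w]"
    by (intro filter_cong) auto
  moreover have range: "[0..<length w] = [0..<length u] @ length u # [Suc (length u)..<length w]"
    using upt_conv_Cons[of "length u" "length w"] upt_add_eq_append[of 0 "length u" "Suc (length v)"] by (simp add: w)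
  moreover have "filter (\<lambda>j. j \<noteq> length u) [0..<length w] = [0..<length u] @ [Suc (length u)..<length w]"
    unfolding range by (simp add: filter_id_conv)
  ultimately have "vertex_word w (length w - 1) (length w) =
      map ((!) w) [0..<length u] @ map ((!) w) [Suc (length u)..<length w]"
    unfolding vertex_word_def by simp
  moreover have "map ((!) w) [0..<length u] = u"
    by (rule nth_equalityI) (simp_all add: w nth_append)
  moreover have "map ((!) w) [Suc (length u)..<length w] = v"
    by (rule nth_equalityI) (simp_all add: w nth_append del: upt_Suc)
  ultimately show ?thesis
    by (simp add: P_level_def vertex_P_def)
qed

section \<open>The test along a word\<close>

lemma extension_chain:
  assumes "extension m T U" and "\<And>x. x \<in> set v \<Longrightarrow> Plain 1 \<le> x \<and> x \<le> Plain m"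
  shows "extension m (insert_word v T) (insert_word v U)"
  using assms
proof (induction v arbitrary: T U)
  case (Cons x v)
  have "extension m (insert_from 1 x T) (insert_from 1 x U)"
    using Cons.prems by (intro extension_step(1)) auto
  then show ?case
    using Cons.IH Cons.prems(2) by simp
qed simp

lemma worked_back_extension_word:
  assumes w: "\<And>x. x \<in> set (drop j0 w) \<Longrightarrow> Plain 1 \<le> x \<and> x \<le> Plain m"
    and ext: "extension m (berele_rows (take j0 w)) X0" and f: "f = length w"
    and lower: "\<And>i. i \<le> f \<Longrightarrow> \<kappa> i = cells (berele_rows (take i w))"
    and wb: "worked_back (Bar m) f \<kappa> (cells (insert_word (drop j0 w) X0)) j \<mu>" and "j0 \<le> f"
  shows "j \<le> j0 \<Longrightarrow> \<mu> j0 = cells X0"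
    and "j0 < j \<Longrightarrow> j \<le> f \<Longrightarrow> \<not> local_rule (Bar m) Circ A (\<mu> j) (\<kappa> (j - 1)) (\<kappa> j)"
proof -
  define X where "X i = insert_word (drop j0 (take i w)) X0" for i
  let ?R = "\<lambda>i. berele_rows (take i w)"
  have R: "?R i = insert_word (drop j0 (take i w)) (?R j0)" if "j0 \<le> i" for i
  proof -
    have "take i w = take j0 w @ drop j0 (take i w)"
      using that by (metis append_take_drop_id min.absorb1 take_take)
    then show ?thesis
      by (metis berele_rows_def fold_append comp_apply)
  qed
  have chain: "extension m (?R i) (X i) \<and> (\<exists>x. Plain 1 \<le> x \<and> x \<le> Plain m \<and>
      ?R (Suc i) = insert_from 1 x (?R i) \<and> X (Suc i) = insert_from 1 x (X i))" if i: "j0 \<le> i" "i < f" for i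
  proof (intro conjI exI)
    have "set (drop j0 (take i w)) \<subseteq> set (drop j0 w)"
      unfolding drop_take using set_take_subset by fastforce
    then show "extension m (?R i) (X i)"
      unfolding R[OF i(1)] X_def using w by (intro extension_chain[OF ext]) blast
    have "w ! i = drop j0 w ! (i - j0)" "i - j0 < length (drop j0 w)"
      using i f by simp_all
    then have "w ! i \<in> set (drop j0 w)"
      using nth_mem by metis
    then show "Plain 1 \<le> w ! i" "w ! i \<le> Plain m"
      using w by blast+
    have "take (Suc i) w = take i w @ [w ! i]"
      using i f by (simp add: take_Suc_conv_app_nth)
    then show "?R (Suc i) = insert_from 1 (w ! i) (?R i)" "X (Suc i) = insert_from 1 (w ! i) (X i)"
      using i f by (simp_all add: berele_rows_def X_def)
  qed
  have Xf: "X f = insert_word (drop j0 w) X0" and X0: "X j0 = X0"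
    by (simp_all add: X_def f)
  show "\<mu> j0 = cells X0" if "j \<le> j0"
  proof -
    have "\<mu> j0 = cells (X j0)"
    proof (rule worked_back_extension(1)[where R = ?R and X = X])
      show "worked_back (Bar m) f \<kappa> (cells (X f)) j \<mu>"
        using wb by (simp only: Xf)
    qed (use chain lower that assms(6) in blast)+
    then show ?thesis by (simp only: X0)
  qed
  show "\<not> local_rule (Bar m) Circ A (\<mu> j) (\<kappa> (j - 1)) (\<kappa> j)" if "j0 < j" "j \<le> f"
  proof (rule worked_back_extension(2)[where R = ?R and X = X])
    show "worked_back (Bar m) f \<kappa> (cells (X f)) j \<mu>"
      using wb by (simp only: Xf)
  qed (use chain lower that in blast)+
qed

lemma letter_eq_of_index: "index x = m \<Longrightarrow> x = Plain m \<or> x = Bar m"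
  by (cases x) auto

theorem theorem3p4:
  fixes n f l :: nat and w :: "letter list" and P Pbar :: tableau and Q :: "shape list"
  assumes "1 \<le> n" and "set w \<subseteq> Gamma n" and "length w = f" and "1 \<le> f"
    and "P = berele_P w" and "Q = berele_Q w"
    and "l = Max ((\<lambda>j. nrows (Q ! j)) ` {0..f})"
    and "Pbar = add_to_first_column (Plain l) P"
  shows "(\<forall>\<gamma>. largest \<gamma> (ran P) \<and> index \<gamma> > l \<longrightarrow>
            largest \<gamma> (set w) \<and> in_stratum w \<gamma> f \<and> deletes_rightmost \<gamma> P (P_level w (f - 1)))
       \<and> ((\<forall>\<gamma>. largest \<gamma> (ran P) \<longrightarrow> index \<gamma> \<le> l) \<longrightarrow>
            (Bar l \<in> ran P \<longrightarrow>
               largest (Bar l) (set w) \<and> in_stratum w (Bar l) f \<and>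
               deletes_rightmost (Bar l) P (P_level w (f - 1)))
          \<and> (Bar l \<notin> ran P \<and> \<not> (\<exists>j\<in>{1..f}. plus_box l (Q ! j) (Q ! (j - 1))) \<longrightarrow>
               largest (Plain l) (set w) \<and> largest (Plain l) (ran P) \<and> in_stratum w (Plain l) f \<and>
               deletes_rightmost (Plain l) P (P_level w (f - 1)))
          \<and> (Bar l \<notin> ran P \<and> (\<exists>j\<in>{1..f}. plus_box l (Q ! j) (Q ! (j - 1))) \<longrightarrow>
               (reaches_left_edge (Bar l) f ((!) Q) (dom Pbar) \<longrightarrow>
                  P_level w (f - 1) \<noteq> Pbar \<and>
                  largest (Plain l) (set w) \<and> largest (Plain l) (ran P) \<and> in_stratum w (Plain l) f \<and>
                  deletes_rightmost (Plain l) P (P_level w (f - 1)))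
             \<and> (encounters_circ (Bar l) f ((!) Q) (dom Pbar) \<longrightarrow>
                  P_level w (f - 1) = Pbar \<and>
                  largest (Bar l) (set w) \<and> in_stratum w (Bar l) f)))"
proof -
  let ?R = "\<lambda>j. berele_rows (take j w)"
  have "w \<noteq> []" using assms(3,4) by auto
  define g where "g = Max (set w)"
  have g_max: "x \<le> g" if "x \<in> set w" for x
    using that by (simp add: g_def)
  have "g \<in> set w"
    using \<open>w \<noteq> []\<close> by (simp add: g_def)
  then obtain u v where w: "w = u @ g # v" and gv: "g \<notin> set v"
    by (metis split_list_last)
  have pos: "Plain 1 \<le> x" if "x \<in> set w" for x
    using assms(2) that by (auto simp: Gamma_def Plain_le_iff)
  have index_le: "index x \<le> index g" if "x \<in> set w" for x
    using g_max[OF that] by (auto simp: less_eq_letter_def less_letter_def)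
  have v: "Plain 1 \<le> x \<and> x < g" if "x \<in> set v" for x
    using that pos[of x] g_max[of x] gv by (auto simp: w order_less_le)
  have tab: "sp_tableau 1 (?R j)" for j
    unfolding berele_rows_def using pos set_take_subset[of j w] by (intro insert_word_sp_tableau) auto
  have letters: "letters (?R j) \<subseteq> set w" for j
    unfolding berele_rows_def using letters_insert_word[of "take j w" "[]"] set_take_subset[of j w] by auto
  have Q: "Q ! j = cells (?R j)" if "j \<le> f" for j
    using that assms(3) unfolding assms(6) berele_Q_def berele_P_def dom_filling
    by (subst nth_map) (auto simp del: upt_Suc)
  have Rf: "?R f = berele_rows w"
    using assms(3) by simp
  have ranP: "ran P = letters (?R f)"
    by (simp only: assms(5) berele_P_def ran_filling Rf)
  have nrows: "nrows (Q ! j) = length (?R j)" if "j \<le> f" for j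
    using Q[OF that] nrows_cells[OF tab] by simp
  have length_le: "length (?R j) \<le> l" if "j \<le> f" for j
    unfolding assms(7) using that nrows by (intro Max_ge) (auto simp: image_iff)
  have "length (?R j) \<le> index g" for j
    using length_sp_tableau_le[OF tab[of j], of "index g"] letters[of j] index_le by fastforce
  \<comment> \<open>Rows are bounded by the largest index in w. If g survives in P, the assumption
    of cases (2) to (5) gives the converse inequality, so that g is \<open>Plain l\<close> or
    \<open>Bar l\<close>.\<close>
  then have l_le: "l \<le> index g"
    unfolding assms(7) using nrows by (subst Max_le_iff) auto
  have stratum: "in_stratum w g f" and level: "P_level w (f - 1) = berele_P (u @ v)"
    using in_stratum_max[OF w gv g_max] P_level_delete_last_max[OF w gv g_max] assms(3) by auto
  have largest_g: "largest g (set w)"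
    using \<open>g \<in> set w\<close> g_max by (simp add: largest_def)
  let ?T = "berele_rows u"
  have T: "sp_tableau 1 ?T" and lT: "letters ?T \<subseteq> set w"
    using tab[of "length u"] letters[of "length u"] by (simp_all add: w)
  have ins_g: "insert_from 1 g ?T = add_at 0 g ?T"
    using lT g_max by (intro insert_from_max) blast
  have U: "sp_tableau 1 (add_at 0 g ?T)"
    using insert_from_sp_tableau(1)[OF T pos[OF \<open>g \<in> set w\<close>]] ins_g by simp
  have run: "berele_rows (u @ g # v1) = insert_word v1 (add_at 0 g ?T)"
    "berele_rows (u @ v1) = insert_word v1 ?T" for v1
    using ins_g by (simp_all add: berele_rows_def)
  have runs: "(\<exists>r\<le>length (insert_word v ?T).
      insert_word v (add_at 0 g ?T) = add_at r g (insert_word v ?T) \<and> clear g r (insert_word v ?T)) \<or>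
    (\<exists>v1 x v2 m. v = v1 @ x # v2 \<and> g = Bar m \<and>
      extension m (insert_word (v1 @ [x]) (add_at 0 g ?T)) (insert_word (v1 @ [x]) ?T) \<and>
      cells (insert_word (v1 @ [x]) ?T) = cells (insert_word v1 (add_at 0 g ?T)) \<and>
      plus_box m (cells (insert_word (v1 @ [x]) (add_at 0 g ?T))) (cells (insert_word v1 (add_at 0 g ?T))))"
    using T U lT g_max v by (intro insert_word_add_at) auto
  consider (grow) r where "r \<le> length (berele_rows (u @ v))"
      "berele_rows w = add_at r g (berele_rows (u @ v))" "clear g r (berele_rows (u @ v))"
    | (circ) v1 x v2 m where "v = v1 @ x # v2" "g = Bar m"
      "extension m (berele_rows (u @ g # v1 @ [x])) (berele_rows (u @ v1 @ [x]))"
      "cells (berele_rows (u @ v1 @ [x])) = cells (berele_rows (u @ g # v1))"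
      "plus_box m (cells (berele_rows (u @ g # v1 @ [x]))) (cells (berele_rows (u @ g # v1)))"
    using runs[folded run, folded w] by blast
  then show ?thesis
  proof cases
    case grow
    let ?T' = "berele_rows (u @ v)"
    have T': "sp_tableau 1 ?T'"
      unfolding berele_rows_def using pos by (intro insert_word_sp_tableau) (auto simp: w)
    have deletes: "deletes_rightmost g P (P_level w (f - 1))"
      unfolding assms(5) level berele_P_def grow(2)
      using T' grow(1,3) by (rule deletes_rightmost_add_at)
    have "g \<in> ran P"
      unfolding ranP Rf grow(2) using letters_add_at[OF grow(1)] by blast
    then have largest_P: "largest g (ran P)"
      using letters[of f] g_max unfolding largest_def ranP by blast
    have unique: "\<gamma> = g" if "largest \<gamma> (ran P)" for \<gamma>
      using that largest_P by (auto simp: largest_def intro: antisym)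
    have index_g: "index g = l" if "\<forall>\<gamma>. largest \<gamma> (ran P) \<longrightarrow> index \<gamma> \<le> l"
      using that largest_P l_le by auto
    have g_Bar: "g = Bar l" if "index g = l" "Bar l \<in> ran P"
      using letter_eq_of_index[OF that(1)] largest_P that(2) unfolding largest_def
      by (auto simp: less_eq_letter_def less_letter_def)
    have g_Plain: "g = Plain l" if "index g = l" "Bar l \<notin> ran P"
      using letter_eq_of_index[OF that(1)] \<open>g \<in> ran P\<close> that(2) by auto
    \<comment> \<open>For \<open>g = Plain l\<close> the empty tableau has the extension
      \<open>[[Plain l]]\<close>, so the test can be retraced down to vertex 0 without a circle;
      this excludes the hypothesis of (5). The inequality is a matter of size: the shape of P has
      one box more than that of \<open>?T'\<close>, and the shape of \<open>Pbar\<close> has again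
      one more.\<close>
    have plain: "P_level w (f - 1) \<noteq> Pbar \<and> \<not> encounters_circ (Bar l) f ((!) Q) (dom Pbar)" if "g = Plain l"
    proof -
      have gamma: "Plain 1 \<le> x \<and> x \<le> Plain l" if "x \<in> set (drop 0 w)" for x
        using that pos g_max \<open>g = Plain l\<close> by auto
      have "index g \<ge> 1"
        using pos[OF \<open>g \<in> set w\<close>] by (simp add: Plain_le_iff)
      then have start: "extension l (?R 0) [[Plain l]]"
        using \<open>g = Plain l\<close> by (simp add: extension_def berele_rows_def Plain_le_iff)
      let ?X = "insert_word (drop 0 w) [[Plain l]]"
      have "extension l (insert_word (drop 0 w) (?R 0)) ?X"
        using start gamma by (rule extension_chain)
      then have ext: "extension l (berele_rows w) ?X"
        by (simp add: berele_rows_def)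
      have Pbar: "Pbar = filling ?X"
        unfolding assms(5,8) berele_P_def using ext by (rule extension_add_to_first_column)
      have "P_level w (f - 1) \<noteq> Pbar"
      proof
        assume "P_level w (f - 1) = Pbar"
        then have "cells ?T' = cells ?X"
          using dom_filling unfolding level berele_P_def Pbar by metis
        moreover obtain r' where "grows r' (berele_rows w) ?X"
          using ext by (rule extension_grows)
        moreover have "grows r ?T' (berele_rows w)"
          using grows_add_at[OF grow(1)] grow(2) by simp
        ultimately show False
          using cells_grows by blast
      qed
      moreover have "\<not> encounters_circ (Bar l) f ((!) Q) (dom Pbar)"
      proof
        assume "encounters_circ (Bar l) f ((!) Q) (dom Pbar)"
        then obtain j \<mu> A where j: "j \<in> {1..f}" and wb: "worked_back (Bar l) f ((!) Q) (dom Pbar) j \<mu>"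
          and circ: "local_rule (Bar l) Circ A (\<mu> j) (Q ! (j - 1)) (Q ! j)"
          unfolding encounters_circ_def by blast
        have wb': "worked_back (Bar l) f ((!) Q) (cells ?X) j \<mu>"
          using wb unfolding Pbar dom_filling .
        have "0 < j" "j \<le> f" using j by auto
        then have "\<not> local_rule (Bar l) Circ A (\<mu> j) (Q ! (j - 1)) (Q ! j)"
          by (intro worked_back_extension_word(2)[OF gamma start assms(3)[symmetric] Q wb']) auto
        then show False using circ by contradiction
      qed
      ultimately show ?thesis by blast
    qed
    show ?thesis
    proof (cases "\<forall>\<gamma>. largest \<gamma> (ran P) \<longrightarrow> index \<gamma> \<le> l")
      case True
      show ?thesis
      proof (cases "Bar l \<in> ran P")
        case in_P: True
        note g = g_Bar[OF index_g[OF True] in_P]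
        show ?thesis
          using True in_P largest_g stratum deletes unfolding g by auto
      next
        case False
        note g = g_Plain[OF index_g[OF True] False]
        show ?thesis
          using True False largest_g largest_P stratum deletes plain[OF g] unfolding g by auto
      qed
    next
      case False
      then show ?thesis
        using largest_g stratum deletes unique by blast
    qed
  next
    case (circ v1 x v2 m)
    \<comment> \<open>The cancelled cell lies between the vertices \<open>j0 - 1\<close> and
      \<open>j0\<close>.\<close>
    define j0 where "j0 = Suc (Suc (length (u @ v1)))"
    let ?X = "berele_rows (u @ v)"
    have w': "w = (u @ g # v1 @ [x]) @ v2" and j0: "j0 = length (u @ g # v1 @ [x])"
      by (simp_all add: w circ(1) j0_def)
    have "j0 \<le> f" "0 < j0"
      using assms(3) by (simp_all add: w' j0)
    have take: "take j0 w = u @ g # v1 @ [x]" "take (j0 - 1) w = u @ g # v1" "drop j0 w = v2"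
      by (simp_all add: w' j0)
    have v2: "Plain 1 \<le> y \<and> y \<le> Plain m" if "y \<in> set (drop j0 w)" for y
      using v[of y] that unfolding take(3) circ(1,2) by (simp add: less_Bar_iff)
    have start: "extension m (?R j0) (berele_rows (u @ v1 @ [x]))"
      using circ(3) by (simp only: take(1))
    have X: "?X = insert_word (drop j0 w) (berele_rows (u @ v1 @ [x]))"
      by (simp add: take(3) circ(1) berele_rows_def)
    have "berele_rows w = insert_word (drop j0 w) (?R j0)"
      by (metis append_take_drop_id berele_rows_def comp_apply fold_append)
    then have ext: "extension m (berele_rows w) ?X"
      unfolding X using extension_chain[OF start v2] by simp
    have "j0 - 1 \<le> f" using \<open>j0 \<le> f\<close> by simp
    note Qj0 = Q[OF \<open>j0 \<le> f\<close>, unfolded take(1)] Q[OF \<open>j0 - 1 \<le> f\<close>, unfolded take(2)]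
    have shrink: "plus_box m (Q ! j0) (Q ! (j0 - 1))"
      using circ(5) unfolding Qj0 .
    then obtain c where "(m, c) \<in> cells (?R (j0 - 1))"
      using Q[of "j0 - 1"] \<open>j0 \<le> f\<close> unfolding plus_box_def by auto
    then have "m \<le> length (?R (j0 - 1))"
      by (auto simp: cells_def rowlen_def split: if_splits)
    \<comment> \<open>Row m is occupied just before the cancellation, so m is at most l; conversely,
      l is at most the index m of g.\<close>
    then have "m = l"
      using length_le[OF \<open>j0 - 1 \<le> f\<close>] l_le circ(2) by simp
    have Pbar: "Pbar = filling ?X"
      unfolding assms(5,8) berele_P_def using ext[unfolded \<open>m = l\<close>] by (rule extension_add_to_first_column)
    have le_P: "z \<le> Plain l" if "z \<in> ran P" for z
      using ext that unfolding ranP Rf extension_def \<open>m = l\<close> by blast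
    have no_Bar: "Bar l \<notin> ran P"
      using le_P[of "Bar l"] by (auto simp: less_eq_letter_def less_letter_def)
    have index_P: "index \<gamma> \<le> l" if "largest \<gamma> (ran P)" for \<gamma>
      using le_P[of \<gamma>] that by (auto simp: largest_def less_eq_letter_def less_letter_def)
    have ex_shrink: "\<exists>j\<in>{1..f}. plus_box l (Q ! j) (Q ! (j - 1))"
      using shrink \<open>j0 \<le> f\<close> \<open>0 < j0\<close> unfolding \<open>m = l\<close> by (intro bexI[of _ j0]) auto
    \<comment> \<open>At the cell of cancellation the retraced upper right shape equals the lower
      left one. A further shrink would have to come from \<open>RuleYa\<close> with a box removed in
      row m, which requires a stratum of at least \<open>Plain (Suc m)\<close>, but the test runs in
      the stratum of \<open>Bar m\<close>.\<close>
    have not_left: "\<not> reaches_left_edge (Bar l) f ((!) Q) (dom Pbar)"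
    proof
      assume "reaches_left_edge (Bar l) f ((!) Q) (dom Pbar)"
      then obtain \<mu> where wb: "worked_back (Bar m) f ((!) Q) (cells ?X) 0 \<mu>"
        unfolding reaches_left_edge_def Pbar dom_filling \<open>m = l\<close> by blast
      then have "\<mu> j0 = cells (berele_rows (u @ v1 @ [x]))"
        using \<open>j0 \<le> f\<close> unfolding X
        by (intro worked_back_extension_word(1)[OF v2 start assms(3)[symmetric] Q]) auto
      also have "\<dots> = Q ! (j0 - 1)"
        using circ(4) unfolding Qj0 .
      finally have \<mu>: "\<mu> j0 = Q ! (j0 - 1)" .
      have "covers (\<mu> (j0 - 1)) (Q ! (j0 - 1))"
        using wb \<open>j0 \<le> f\<close> unfolding worked_back_def by auto
      moreover obtain \<rho> where "local_rule (Bar m) \<rho> (\<mu> (j0 - 1)) (\<mu> j0) (Q ! (j0 - 1)) (Q ! j0)"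
      proof -
        have "j0 \<in> {0<..f}"
          using \<open>j0 \<le> f\<close> \<open>0 < j0\<close> by simp
        then show ?thesis
          using wb that unfolding worked_back_def by blast
      qed
      moreover have "covers (Q ! (j0 - 1)) (Q ! j0)"
        using shrink unfolding covers_def by blast
      ultimately obtain k where "plus_box k (Q ! j0) (Q ! (j0 - 1))" "Plain (Suc k) \<le> Bar m"
        using local_rule_backwards_shrink \<mu> by metis
      then show False
        using plus_box_unique_row[OF shrink] by (auto simp: Plain_le_iff)
    qed
    have "P_level w (f - 1) = Pbar"
      unfolding level Pbar berele_P_def ..
    then show ?thesis
      using index_P no_Bar ex_shrink not_left largest_g stratum circ(2) unfolding \<open>m = l\<close>
      by (auto dest: leD)
  qed
qed

end
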